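(* Fix $\chi\in\mathcal{E}$ and $\ell\in[0,1]$. Assume: (1) $r$ and $\sigma_\varepsilon^2$ are continuous on a neighborhood of $\chi$, $F(0)=0$, and $\varphi(t):=E[r(\mathcal{X})-r(\chi)\mid \|\mathcal{X}-\chi\|=t]$ is differentiable at $t=0$; (2) $K$ is a nonnegative bounded kernel with support $[0,1]$ and $\inf_{t\in[0,1]}K(t)>0$; (3) for every $s\in[0,1]$, $\tau_h(s):=F(hs)/F(h)\to\tau_0(s)<\infty$ as $h\to0$; (4) as $n\to\infty$, $h_n\to0$, $nF(h_n)\to\infty$, $A_{n,\ell}:=\frac1n\sum_{i=1}^n\frac{h_i}{h_n}\left[\frac{F(h_i)}{F(h_n)}\right]^{1-\ell}\to\alpha_{[\ell]}<\infty$, and for every real $q\le 2$, $B_{n,q}:=\frac1n\sum_{i=1}^n\left[\frac{F(h_i)}{F(h_n)}\right]^q\to\beta_{[q]}<\infty$; (5) there exist $\lambda>0$ and $\mu>0$ such that $E[\exp(\lambda|Y|^\mu)]<\infty$; (6) for every $\delta>0$, $\lim_{n\to\infty}\frac{(\ln n)^\delta}{\sqrt{nF(h_n)}}=0$. If there exists $c\ge0$ such that $\lim_{n\to\infty}h_n\sqrt{nF(h_n)}=c$, then, in distribution as $n\to\infty$, $$\sqrt{nF(h_n)}\left(r_n^{[\ell]}(\chi)-r(\chi)\right)\stackrel{\mathcal{D}}{\longrightarrow}\mathcal{N}\left(c\,\frac{\alpha_{[\ell]}}{\beta_{[1-\ell]}}\frac{M_0}{M_1}\varphi'(0),\ \f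rac{\beta_{[1-2\ell]}}{\beta_{[1-\ell]}^2}\frac{M_2}{M_1^2}\sigma_\varepsilon^2(\chi)\right).$$
   Context: $\mathcal{E}$ is a Banach space endowed with a semi-norm $\|\cdot\|$ (neighborhoods and balls are taken with respect to $\|\cdot\|$). $(\mathcal{X},Y)$ is a random pair with values in $\mathcal{E}\times\mathbb{R}$ and $(\mathcal{X}_i,Y_i)_{i\ge1}$ are i.i.d. copies of it. The model is $Y_i=r(\mathcal{X}_i)+\varepsilon_i$ with $r(\chi)=E(Y\mid\mathcal{X}=\chi)$, $E(\varepsilon_i\mid\mathcal{X}_i)=0$ and $E(\varepsilon_i^2\mid\mathcal{X}_i)=\sigma_\varepsilon^2(\mathcal{X}_i)<\infty$. $F(t)=P(\|\chi-\mathcal{X}\|\le t)$, and $(h_n)$ is a sequence of positive bandwidths. The estimator is $$r_n^{[\ell]}(\chi)=\frac{\sum_{i=1}^n\frac{Y_i}{F(h_i)^\ell}K\left(\frac{\|\chi-\mathcal{X}_i\|}{h_i}\right)}{\sum_{i=1}^n\frac{1}{F(h_i)^\ell}K\left(\frac{\|\chi-\mathcal{X}_i\|}{h_i}\right)}$$ (with $0/0=0$). $K$ is differentiable on $[0,1]$ with integrable derivative, and $M_0=K(1)-\int_0^1(sK(s))'\tau_0(s)\,ds$, $M_1=K(1)-\int_0^1K'(s)\tau_0(s)\,ds$, $M_2=K^2(1)-\int_0^1(K^2(s))'\tau_0(s)\,ds$. $\mathcal{N}(m,v)$ is the normal law with mean $m$ and variance $v$. *)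

theory Defs
  imports "HOL-Probability.Probability"
begin

definition seminorm :: "('e::real_vector \<Rightarrow> real) \<Rightarrow> bool" where
  "seminorm p \<longleftrightarrow>
     (\<forall>x. 0 \<le> p x) \<and> (\<forall>x y. p (x + y) \<le> p x + p y) \<and> (\<forall>a x. p (a *\<^sub>R x) = \<bar>a\<bar> * p x)"

definition seminorm_continuous_near :: "('e::real_vector \<Rightarrow> real) \<Rightarrow> 'e \<Rightarrow> ('e \<Rightarrow> real) \<Rightarrow> bool" where
  "seminorm_continuous_near p chi f \<longleftrightarrow>
     (\<exists>\<rho>>0. \<forall>x. p (x - chi) < \<rho> \<longrightarrow>
        (\<forall>e>0. \<exists>d>0. \<forall>y. p (y - x) < d \<longrightarrow> \<bar>f y - f x\<bar> < e))"

text \<open>The function \<open>g\<close> is a version of \<open>x \<mapsto> E[Z | X = x]\<close>, i.e. \<open>g \<circ> X\<close> is almost surely the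
  conditional expectation of the integrable variable \<open>Z\<close> given the sigma-algebra generated by \<open>X\<close>.\<close>

definition cond_exp_given ::
    "'w measure \<Rightarrow> ('w \<Rightarrow> 'x::topological_space) \<Rightarrow> ('w \<Rightarrow> real) \<Rightarrow> ('x \<Rightarrow> real) \<Rightarrow> bool" where
  "cond_exp_given M X Z g \<longleftrightarrow>
     g \<in> borel_measurable borel \<and> integrable M Z \<and>
     (AE \<omega> in M. real_cond_exp M (vimage_algebra (space M) X borel) Z \<omega> = g (X \<omega>))"

definition recursive_estimator ::
    "('e::real_vector \<Rightarrow> real) \<Rightarrow> (real \<Rightarrow> real) \<Rightarrow> (real \<Rightarrow> real) \<Rightarrow> (nat \<Rightarrow> real) \<Rightarrow> real \<Rightarrow>
     (nat \<Rightarrow> 'w \<Rightarrow> 'e) \<Rightarrow> (nat \<Rightarrow> 'w \<Rightarrow> real) \<Rightarrow> 'e \<Rightarrow> nat \<Rightarrow> 'w \<Rightarrow> real" where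
  "recursive_estimator p K F h l Xs Ys chi n \<omega> =
     (\<Sum>i=1..n. Ys i \<omega> / F (h i) powr l * K (p (chi - Xs i \<omega>) / h i)) /
     (\<Sum>i=1..n. 1 / F (h i) powr l * K (p (chi - Xs i \<omega>) / h i))"

text \<open>Derivatives on \<open>[0,1]\<close> are one-sided at the end points, where a kernel supported on
  \<open>[0,1]\<close> may jump to zero.\<close>

definition deriv01 :: "(real \<Rightarrow> real) \<Rightarrow> real \<Rightarrow> real" where
  "deriv01 f s = vector_derivative f (at s within {0..1})"

definition M0 :: "(real \<Rightarrow> real) \<Rightarrow> (real \<Rightarrow> real) \<Rightarrow> real" where
  "M0 K \<tau>0 = K 1 - (LBINT s:{0..1}. deriv01 (\<lambda>s. s * K s) s * \<tau>0 s)"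

definition M1 :: "(real \<Rightarrow> real) \<Rightarrow> (real \<Rightarrow> real) \<Rightarrow> real" where
  "M1 K \<tau>0 = K 1 - (LBINT s:{0..1}. deriv01 K s * \<tau>0 s)"

definition M2 :: "(real \<Rightarrow> real) \<Rightarrow> (real \<Rightarrow> real) \<Rightarrow> real" where
  "M2 K \<tau>0 = (K 1)\<^sup>2 - (LBINT s:{0..1}. deriv01 (\<lambda>s. (K s)\<^sup>2) s * \<tau>0 s)"

text \<open>The normal law with mean \<open>m\<close> and variance \<open>v\<close>; for \<open>v = 0\<close> it is the point mass at \<open>m\<close>.
  Note that \<open>normal_density\<close> is parametrised by the standard deviation.\<close>

definition normal_law :: "real \<Rightarrow> real \<Rightarrow> real measure" where
  "normal_law m v =
     (if v = 0 then return borel m else density lborel (normal_density m (sqrt v)))"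

end

theory Submission
  imports Defs
begin

text \<open>
  Write \<open>T\<^sub>i = Y\<^sub>i - r chi\<close> and \<open>U\<^sub>i = K (\<parallel>chi - X\<^sub>i\<parallel> / h\<^sub>i)\<close>.  Up to the event that the denominator
  vanishes, the normalised error is \<open>S\<^sub>n / D\<^sub>n\<close>, where \<open>S\<^sub>n\<close> is a multiple of the sum of
  \<open>F(h\<^sub>i) powr (-l) * U\<^sub>i * T\<^sub>i\<close> and \<open>D\<^sub>n\<close> one of the sum of \<open>F(h\<^sub>i) powr (-l) * U\<^sub>i\<close>.  The second moment
  of \<open>D\<^sub>n\<close> about its limit tends to \<open>0\<close>, and \<open>S\<^sub>n\<close> is a row sum of a triangular array satisfying
  Lindeberg's condition, so Slutsky's argument (carried out on characteristic functions) applies.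

  The constants \<open>M0\<close>, \<open>M1\<close>, \<open>M2\<close> come from writing \<open>K u = K 1 - (integral of K' over [u, 1])\<close> and
  exchanging expectation and integral; the constants \<open>\<alpha>\<close>, \<open>\<beta>\<close> come from averaging the convergent
  sequences of single-observation moments with the weights \<open>F(h\<^sub>i) powr q\<close>.  The conditional law of
  \<open>Y\<close> is controlled only up to its second moment; truncating \<open>Y\<close> at a power of \<open>ln n\<close> gives
  Lindeberg's condition, the exponential moment taking care of the tail.  Finally \<open>\<beta> (1 - l)\<close> is
  positive because Cauchy-Schwarz gives \<open>\<beta> q * \<beta> (- q) \<ge> 1\<close>.
\<close>

subsection \<open>Weighted averages\<close>

text \<open>The rate comes out of the normalisations: the denominator is divided by the order
  \<open>n * f n powr (1 - l)\<close> of its mean, the numerator by the square root of the order of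
  its variance, and the two scalings differ by exactly \<open>sqrt (n * f n)\<close>.

  The numerator is not centred. When \<open>h n * sqrt (n * F (h n))\<close> tends to
  \<open>c\<close>, its bias is at most of the order of its fluctuations, so the array keeps its
  means and their sum supplies the mean of the limit law.

  The obstacle in Lindeberg's condition is localisation. Below the truncation level the kernel still
  confines the observation to a small ball, which gains a factor \<open>F (h i)\<close>. Above it
  the kernel is bounded by a constant and this factor is lost, so that the tail bound is multiplied
  by a quantity of order \<open>1 / f n\<close>. Since \<open>n * f n\<close> tends to infinity, a
  tail of order \<open>1 / n^2\<close> pays for the loss, and this requirement dictates the power of
  \<open>ln n\<close> used as truncation level.\<close>

lemma weighted_sum_tendsto:
  fixes c w a :: "nat \<Rightarrow> real"
  assumes c: "c \<longlonglongrightarrow> 0" "\<And>n. 0 \<le> c n"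
    and w: "\<And>i. i \<ge> 1 \<Longrightarrow> 0 \<le> w i"
    and L: "(\<lambda>n. c n * (\<Sum>i=1..n. w i)) \<longlonglongrightarrow> L"
    and a: "a \<longlonglongrightarrow> A"
  shows "(\<lambda>n. c n * (\<Sum>i=1..n. w i * a i)) \<longlonglongrightarrow> L * A"
proof -
  have "(\<lambda>n. c n * (\<Sum>i=1..n. w i * (a i - A))) \<longlonglongrightarrow> 0"
  proof (rule LIMSEQ_I)
    fix e :: real assume e: "0 < e"
    \<comment> \<open>Toeplitz's argument: the terms up to \<open>N\<close> form a fixed number
      \<open>C\<close>, which the factor \<open>c n\<close> sends to 0; the later ones cost at most
      \<delta> times a weight total that stays below \<open>\<bar>L\<bar> + 1\<close>. Each share is
      \<open>e / 2\<close>.\<close>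
    define \<delta> where "\<delta> = e / (2 * (\<bar>L\<bar> + 1))"
    have \<delta>: "\<delta> > 0" using e by (simp add: \<delta>_def)
    obtain N where N: "\<And>i. i \<ge> N \<Longrightarrow> \<bar>a i - A\<bar> < \<delta>"
      using LIMSEQ_D[OF a \<delta>] by auto
    define C where "C = (\<Sum>i\<in>{1..N}. w i * \<bar>a i - A\<bar>)"
    have "(\<lambda>n. c n * C) \<longlonglongrightarrow> 0" using tendsto_mult_right[OF c(1), of C] by simp
    then have 1: "\<forall>\<^sub>F n in sequentially. c n * C < e / 2"
      by (rule order_tendstoD) (use e in simp)
    have 2: "\<forall>\<^sub>F n in sequentially. c n * (\<Sum>i=1..n. w i) < \<bar>L\<bar> + 1"
      by (rule order_tendstoD[OF L]) simp
    have "\<forall>\<^sub>F n in sequentially. norm (c n * (\<Sum>i=1..n. w i * (a i - A)) - 0) < e"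
      using 1 2
    proof eventually_elim
      case (elim n)
      have "\<bar>\<Sum>i=1..n. w i * (a i - A)\<bar> \<le> (\<Sum>i=1..n. w i * \<bar>a i - A\<bar>)"
        by (rule order_trans[OF sum_abs]) (auto intro!: sum_mono simp: abs_mult w)
      also have "\<dots> \<le> (\<Sum>i=1..n. (if i \<le> N then w i * \<bar>a i - A\<bar> else 0) + \<delta> * w i)"
      proof (rule sum_mono)
        fix i assume i: "i \<in> {1..n}"
        then have "0 \<le> w i" by (simp add: w)
        then show "w i * \<bar>a i - A\<bar> \<le> (if i \<le> N then w i * \<bar>a i - A\<bar> else 0) + \<delta> * w i"
          using N[of i] \<delta> mult_left_mono[of "\<bar>a i - A\<bar>" \<delta> "w i"] by (cases "i \<le> N") (auto simp: mult.commute)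
      qed
      also have "\<dots> = (\<Sum>i\<in>{i \<in> {1..n}. i \<le> N}. w i * \<bar>a i - A\<bar>) + \<delta> * (\<Sum>i=1..n. w i)"
        by (simp only: sum.distrib sum_distrib_left sum.inter_filter[OF finite_atLeastAtMost])
      also have "(\<Sum>i\<in>{i \<in> {1..n}. i \<le> N}. w i * \<bar>a i - A\<bar>) \<le> C"
        unfolding C_def by (rule sum_mono2) (auto simp: w)
      finally have "c n * \<bar>\<Sum>i=1..n. w i * (a i - A)\<bar> \<le> c n * (C + \<delta> * (\<Sum>i=1..n. w i))"
        by (intro mult_left_mono) (auto simp: c)
      also have "\<dots> = c n * C + \<delta> * (c n * (\<Sum>i=1..n. w i))" by (simp add: algebra_simps)
      also have "\<dots> < e / 2 + \<delta> * (\<bar>L\<bar> + 1)"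
        using elim \<delta> by (intro add_strict_mono mult_strict_left_mono)
      also have "\<dots> = e" by (simp add: \<delta>_def field_simps)
      finally show ?case by (simp add: abs_mult c)
    qed
    then show "\<exists>no. \<forall>n\<ge>no. norm (c n * (\<Sum>i=1..n. w i * (a i - A)) - 0) < e"
      by (simp add: eventually_sequentially)
  qed
  from tendsto_add[OF this tendsto_mult_right[OF L, of A]]
  show ?thesis by (simp add: algebra_simps sum.distrib sum_subtractf sum_distrib_left sum_distrib_right)
qed

text \<open>A limit of positive means could be 0; a finite limit for the reciprocal powers excludes
  this. The powers \<open>q / 2\<close> and \<open>- q / 2\<close> multiply to 1 termwise, so the
  product of the two means is at least 1 for every large \<open>n\<close>.\<close>

lemma power_mean_limit_pos:
  fixes x :: "nat \<Rightarrow> nat \<Rightarrow> real"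
  assumes pos: "\<forall>\<^sub>F n in sequentially. \<forall>i\<in>{1..n}. 0 < x n i"
    and b: "(\<lambda>n. 1 / real n * (\<Sum>i=1..n. x n i powr q)) \<longlonglongrightarrow> b"
    and b': "(\<lambda>n. 1 / real n * (\<Sum>i=1..n. x n i powr (- q))) \<longlonglongrightarrow> b'"
  shows "0 < b"
proof -
  have "(\<lambda>n. (1 / real n * (\<Sum>i=1..n. x n i powr q)) * (1 / real n * (\<Sum>i=1..n. x n i powr (- q)))) \<longlonglongrightarrow> b * b'"
    using b b' by (rule tendsto_mult)
  moreover have "\<forall>\<^sub>F n in sequentially. 1 \<le> (1 / real n * (\<Sum>i=1..n. x n i powr q)) * (1 / real n * (\<Sum>i=1..n. x n i powr (- q)))"
    using pos eventually_gt_at_top[of 0]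
  proof eventually_elim
    case (elim n)
    have 1: "(\<Sum>i=1..n. x n i powr (q / 2) * x n i powr (- q / 2)) = real n"
    proof -
      have "x n i powr (q / 2) * x n i powr (- q / 2) = 1" if "i \<in> {1..n}" for i
        using elim(1)[rule_format, OF that] by (simp flip: powr_add)
      then show ?thesis by simp
    qed
    have 2: "(y powr (s / 2))\<^sup>2 = y powr s" if "0 < y" for y s :: real
      using that by (simp add: power2_eq_square flip: powr_add)
    have "(real n)\<^sup>2 \<le> (\<Sum>i=1..n. (x n i powr (q / 2))\<^sup>2) * (\<Sum>i=1..n. (x n i powr (- q / 2))\<^sup>2)"
      using Cauchy_Schwarz_ineq_sum[of "\<lambda>i. x n i powr (q / 2)" "\<lambda>i. x n i powr (- q / 2)" "{1..n}"]
      unfolding 1 .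
    also have "\<dots> = (\<Sum>i=1..n. x n i powr q) * (\<Sum>i=1..n. x n i powr (- q))"
      using elim by (intro arg_cong2[where f="(*)"] sum.cong 2) auto
    finally show ?case using elim by (simp add: field_simps power2_eq_square)
  qed
  ultimately have "1 \<le> b * b'"
    by (rule tendsto_lowerbound) simp
  moreover have "0 \<le> b" by (rule tendsto_lowerbound[OF b]) (auto intro!: always_eventually sum_nonneg divide_nonneg_nonneg)
  ultimately show ?thesis by (cases "b = 0") auto
qed

subsection \<open>Triangular arrays and characteristic functions\<close>

lemma norm_iexp_diff_le: "cmod (iexp x - iexp y) \<le> \<bar>x - y\<bar>"
proof -
  have "iexp x - iexp y = iexp y * (iexp (x - y) - 1)"
    by (simp add: algebra_simps flip: exp_add)
  then have "cmod (iexp x - iexp y) = cmod (iexp (x - y) - 1)"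
    by (simp add: norm_mult)
  also have "\<dots> \<le> \<bar>x - y\<bar>" using iexp_approx1[of "x - y" 0] by simp
  finally show ?thesis .
qed

text \<open>Valid for \<open>a\<close> of any size and all nonnegative \<open>b\<close>, so no
  uniform smallness of the array entries is needed when exponentials replace Taylor polynomials. The
  oscillating and the decaying factor are expanded separately; the cross term
  \<open>\<bar>a\<bar> * b\<close> is absorbed by the squares.\<close>

lemma norm_exp_minus_linear_le:
  fixes a b :: real
  assumes "0 \<le> b"
  shows "cmod (exp (\<i> * a - b) - (1 + \<i> * a - b)) \<le> a\<^sup>2 + b\<^sup>2"
proof -
  have 1: "\<bar>exp (-b) - 1\<bar> \<le> b"
    using exp_ge_add_one_self[of "-b"] assms by (simp add: abs_if)
  have 2: "\<bar>exp (-b) - 1 + b\<bar> \<le> b\<^sup>2 / 2"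
  proof -
    have "0 \<le> exp (-b) - 1 + b" using exp_ge_add_one_self[of "-b"] by simp
    moreover have "exp (-b) - 1 + b \<le> b\<^sup>2 / 2"
    proof -
      have "1 + b + b\<^sup>2 / 2 \<le> exp b" using exp_lower_Taylor_quadratic[OF assms] by simp
      then have "exp (-b) \<le> inverse (1 + b + b\<^sup>2 / 2)"
        using assms by (simp add: exp_minus le_imp_inverse_le add_pos_nonneg)
      also have "\<dots> \<le> 1 - b + b\<^sup>2 / 2"
      proof -
        \<comment> \<open>Multiplied out, this shows that the quadratic Taylor polynomial at
          \<open>- b\<close> dominates the reciprocal of the one at \<open>b\<close>.\<close>
        have "(1 - b + b\<^sup>2 / 2) * (1 + b + b\<^sup>2 / 2) = 1 + b ^ 4 / 4"
          by (simp add: algebra_simps power2_eq_square power4_eq_xxxx)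
        then have "1 \<le> (1 - b + b\<^sup>2 / 2) * (1 + b + b\<^sup>2 / 2)" by simp
        then show ?thesis using assms
          by (simp add: inverse_eq_divide divide_le_eq add_pos_nonneg mult.commute)
      qed
      finally show ?thesis by simp
    qed
    ultimately show ?thesis by simp
  qed
  have 3: "cmod (iexp a - 1 - \<i> * a) \<le> a\<^sup>2 / 2"
    using iexp_approx1[of a 1] by (simp add: power2_eq_square diff_diff_eq)
  have eq: "exp (\<i> * a - b) = iexp a * exp (- b)"
    by (simp add: exp_diff exp_minus divide_inverse exp_of_real)
  have "exp (\<i> * a - b) - (1 + \<i> * a - b) =
      (iexp a - 1 - \<i> * a) * exp (-b) + complex_of_real (exp (-b) - 1 + b) + \<i> * a * complex_of_real (exp (-b) - 1)"
    unfolding eq by (simp add: algebra_simps exp_of_real)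
  also have "cmod \<dots> \<le> cmod (iexp a - 1 - \<i> * a) * exp (-b) + \<bar>exp (-b) - 1 + b\<bar> + \<bar>a\<bar> * \<bar>exp (-b) - 1\<bar>"
    by (intro norm_triangle_le add_mono) (simp_all only: norm_mult norm_of_real norm_ii mult_1_left abs_exp_cancel order_refl)
  also have "\<dots> \<le> a\<^sup>2 / 2 * 1 + b\<^sup>2 / 2 + \<bar>a\<bar> * b"
    using 1 2 3 assms by (intro add_mono mult_mono) auto
  also have "\<dots> \<le> a\<^sup>2 + b\<^sup>2"
    using sum_squares_bound[of "\<bar>a\<bar>" b] by simp
  finally show ?thesis .
qed

text \<open>The discriminant argument: the second moment of \<open>f - t * g\<close> is a
  nonnegative quadratic in \<open>t\<close>.\<close>

lemma (in prob_space) square_expectation_mult_le: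
  fixes f g :: "'a \<Rightarrow> real"
  assumes [measurable]: "random_variable borel f" "random_variable borel g"
    and f: "integrable M (\<lambda>x. (f x)\<^sup>2)" and g: "integrable M (\<lambda>x. (g x)\<^sup>2)"
  shows "integrable M (\<lambda>x. f x * g x)"
    and "(expectation (\<lambda>x. f x * g x))\<^sup>2 \<le> expectation (\<lambda>x. (f x)\<^sup>2) * expectation (\<lambda>x. (g x)\<^sup>2)"
proof -
  show fg: "integrable M (\<lambda>x. f x * g x)"
  proof (rule Bochner_Integration.integrable_bound)
    show "integrable M (\<lambda>x. (f x)\<^sup>2 + (g x)\<^sup>2)" using f g by simp
    have "\<bar>f x * g x\<bar> \<le> (f x)\<^sup>2 + (g x)\<^sup>2" for x
    proof -
      have "2 * \<bar>f x\<bar> * \<bar>g x\<bar> \<le> \<bar>f x\<bar>\<^sup>2 + \<bar>g x\<bar>\<^sup>2" by (rule sum_squares_bound)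
      moreover have "0 \<le> \<bar>f x\<bar> * \<bar>g x\<bar>" by simp
      ultimately show ?thesis unfolding abs_mult power2_abs by linarith
    qed
    then show "AE x in M. norm (f x * g x) \<le> norm ((f x)\<^sup>2 + (g x)\<^sup>2)" by simp
  qed simp
  define p q s where "p = expectation (\<lambda>x. (f x)\<^sup>2)" and "q = expectation (\<lambda>x. (g x)\<^sup>2)"
    and "s = expectation (\<lambda>x. f x * g x)"
  have quad: "0 \<le> p - 2 * t * s + t\<^sup>2 * q" for t
  proof -
    have "0 \<le> expectation (\<lambda>x. (f x - t * g x)\<^sup>2)" by simp
    also have "(\<lambda>x. (f x - t * g x)\<^sup>2) = (\<lambda>x. (f x)\<^sup>2 - 2 * t * (f x * g x) + t\<^sup>2 * (g x)\<^sup>2)"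
      by (simp add: fun_eq_iff power2_eq_square algebra_simps)
    also have "expectation \<dots> = p - 2 * t * s + t\<^sup>2 * q"
      using f g fg by (simp add: p_def q_def s_def)
    finally show ?thesis .
  qed
  have q: "0 \<le> q" unfolding q_def by simp
  show "(expectation (\<lambda>x. f x * g x))\<^sup>2 \<le> expectation (\<lambda>x. (f x)\<^sup>2) * expectation (\<lambda>x. (g x)\<^sup>2)"
    unfolding p_def[symmetric] q_def[symmetric] s_def[symmetric]
  proof (cases "q = 0")
    case True
    have "s = 0"
    proof (rule ccontr)
      assume "s \<noteq> 0"
      \<comment> \<open>With \<open>q = 0\<close> the quadratic degenerates to
        \<open>p - 2 * t * s\<close>, and this choice of \<open>t\<close> gives it the value
        -1.\<close>
      then show False using quad[of "(p + 1) / (2 * s)"] True by simp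
    qed
    then show "s\<^sup>2 \<le> p * q" using True by simp
  next
    case False
    then have "q > 0" using q by simp
    then show "s\<^sup>2 \<le> p * q" using quad[of "s / q"] by (simp add: field_simps power2_eq_square)
  qed
qed

text \<open>Independence factors the off-diagonal products; adding the squared means on the diagonal
  completes the square of the total mean. Uncentred summands are thereby handled without passing to
  variances. It serves both the numerator and the denominator.\<close>

lemma (in prob_space) expectation_square_indep_sum_le:
  fixes X :: "'i \<Rightarrow> 'a \<Rightarrow> real"
  assumes fin: "finite I" and indep: "indep_vars (\<lambda>_. borel) X I"
    and sq: "\<And>i. i \<in> I \<Longrightarrow> integrable M (\<lambda>x. (X i x)\<^sup>2)"
  shows "integrable M (\<lambda>x. (\<Sum>i\<in>I. X i x)\<^sup>2)"
    and "expectation (\<lambda>x. (\<Sum>i\<in>I. X i x)\<^sup>2) \<le>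
      (\<Sum>i\<in>I. expectation (\<lambda>x. (X i x)\<^sup>2)) + (\<Sum>i\<in>I. expectation (X i))\<^sup>2"
proof -
  have rv: "random_variable borel (X i)" if "i \<in> I" for i
    using indep that by (auto simp: indep_vars_def)
  have int: "integrable M (X i)" if "i \<in> I" for i
    using rv[OF that] sq[OF that] by (rule square_integrable_imp_integrable)
  have int2: "integrable M (\<lambda>x. X i x * X j x)" if "i \<in> I" "j \<in> I" for i j
    using that by (intro square_expectation_mult_le rv sq)
  have eq: "(\<lambda>x. (\<Sum>i\<in>I. X i x)\<^sup>2) = (\<lambda>x. \<Sum>i\<in>I. \<Sum>j\<in>I. X i x * X j x)"
    by (simp add: power2_eq_square sum_product)
  show "integrable M (\<lambda>x. (\<Sum>i\<in>I. X i x)\<^sup>2)"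
    unfolding eq by (intro Bochner_Integration.integrable_sum int2)
  have le: "expectation (\<lambda>x. X i x * X j x) \<le>
      expectation (X i) * expectation (X j) + (if j = i then expectation (\<lambda>x. (X i x)\<^sup>2) else 0)"
    if ij: "i \<in> I" "j \<in> I" for i j
  proof (cases "j = i")
    case True
    then show ?thesis by (simp add: power2_eq_square)
  next
    case False
    have "indep_vars (\<lambda>_. borel) X {i, j}" by (rule indep_vars_subset[OF indep]) (use ij in auto)
    then have "expectation (\<lambda>x. \<Prod>k\<in>{i, j}. X k x) = (\<Prod>k\<in>{i, j}. expectation (X k))"
      using int ij by (intro indep_vars_lebesgue_integral) auto
    then show ?thesis using False by simp
  qed
  have "expectation (\<lambda>x. (\<Sum>i\<in>I. X i x)\<^sup>2) = (\<Sum>i\<in>I. \<Sum>j\<in>I. expectation (\<lambda>x. X i x * X j x))"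
    unfolding eq by (simp add: int2 Bochner_Integration.integral_sum)
  also have "\<dots> \<le> (\<Sum>i\<in>I. \<Sum>j\<in>I. expectation (X i) * expectation (X j) +
      (if j = i then expectation (\<lambda>x. (X i x)\<^sup>2) else 0))"
    by (intro sum_mono le)
  also have "\<dots> = (\<Sum>i\<in>I. expectation (\<lambda>x. (X i x)\<^sup>2)) + (\<Sum>i\<in>I. expectation (X i))\<^sup>2"
    using fin by (simp add: sum.distrib sum.delta power2_eq_square sum_product)
  finally show "expectation (\<lambda>x. (\<Sum>i\<in>I. X i x)\<^sup>2) \<le>
      (\<Sum>i\<in>I. expectation (\<lambda>x. (X i x)\<^sup>2)) + (\<Sum>i\<in>I. expectation (X i))\<^sup>2" .
qed

text \<open>Each characteristic function is compared with the exponential carrying the mean and the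
  second moment of its entry. Second moments may stand in for variances because the squared means
  sum to 0 in the limit. Products are compared factor by factor, all factors having modulus at most
  1. The minimum in \<open>lindeberg\<close> is the shape of the remainder in the second-order
  Taylor bound.\<close>

lemma (in prob_space) char_triangular_array:
  fixes V :: "nat \<Rightarrow> 'i \<Rightarrow> 'a \<Rightarrow> real"
  assumes indep: "\<And>n. indep_vars (\<lambda>_. borel) (V n) (I n)"
    and sq: "\<And>n i. i \<in> I n \<Longrightarrow> integrable M (\<lambda>x. (V n i x)\<^sup>2)"
    and fin: "\<And>n. finite (I n)"
    and mean: "(\<lambda>n. \<Sum>i\<in>I n. expectation (V n i)) \<longlonglongrightarrow> m"
    and var: "(\<lambda>n. \<Sum>i\<in>I n. expectation (\<lambda>x. (V n i x)\<^sup>2)) \<longlonglongrightarrow> v"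
    and mean_sq: "(\<lambda>n. \<Sum>i\<in>I n. (expectation (V n i))\<^sup>2) \<longlonglongrightarrow> 0"
    and var_sq: "(\<lambda>n. \<Sum>i\<in>I n. (expectation (\<lambda>x. (V n i x)\<^sup>2))\<^sup>2) \<longlonglongrightarrow> 0"
    and lindeberg: "(\<lambda>n. \<Sum>i\<in>I n. expectation (\<lambda>x. min ((V n i x)\<^sup>2) (\<bar>V n i x\<bar> ^ 3))) \<longlonglongrightarrow> 0"
  shows "(\<lambda>n. char (distr M borel (\<lambda>x. \<Sum>i\<in>I n. V n i x)) t) \<longlonglongrightarrow> exp (\<i> * (m * t) - v * t\<^sup>2 / 2)"
proof -
  define e s where "e n i = expectation (V n i)" and "s n i = expectation (\<lambda>x. (V n i x)\<^sup>2)" for n i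
  define b where "b n i = expectation (\<lambda>x. min ((V n i x)\<^sup>2) (\<bar>V n i x\<bar> ^ 3))" for n i
  define \<psi> where "\<psi> n i = char (distr M borel (V n i)) t" for n i
  define w where "w n i = exp (\<i> * (t * e n i) - (t\<^sup>2 * s n i / 2 :: real))" for n i
  have rv: "random_variable borel (V n i)" if "i \<in> I n" for i n
    using indep[of n] that by (auto simp: indep_vars_def)
  have int: "integrable M (V n i)" if "i \<in> I n" for i n
    using rv[OF that] sq[OF that] by (rule square_integrable_imp_integrable)
  have s0: "0 \<le> s n i" for n i by (simp add: s_def)
  \<comment> \<open>\<open>t\<^sup>2 / 6\<close> is the prefactor of the Taylor bound, and
    \<open>6 + \<bar>t\<bar>\<close> dominates the coefficients 6 and \<open>\<bar>t\<bar>\<close>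
    inside its minimum.\<close>
  define C where "C = t\<^sup>2 / 6 * (6 + \<bar>t\<bar>)"
  have psi: "cmod (\<psi> n i - (1 + \<i> * (t * e n i) - (t\<^sup>2 * s n i / 2 :: real))) \<le> C * b n i"
    if i: "i \<in> I n" for n i
  proof -
    note [measurable] = rv[OF i]
    have intk: "integrable M (\<lambda>x. (V n i x) ^ k)" if "k \<le> 2" for k
    proof -
      from that have "k = 0 \<or> k = 1 \<or> k = 2" by auto
      then show ?thesis using int[OF i] sq[OF i] by auto
    qed
    interpret D: real_distribution "distr M borel (V n i)" by simp
    have *: "cmod (\<psi> n i - (\<Sum>k\<le>2. (\<i> * t) ^ k / fact k * D.expectation (\<lambda>x. x ^ k)))
      \<le> \<bar>t\<bar>\<^sup>2 / fact (Suc 2) * D.expectation (\<lambda>x. min (2 * \<bar>x\<bar>\<^sup>2 * Suc 2) (\<bar>t\<bar> * \<bar>x\<bar> ^ Suc 2))"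
      unfolding \<psi>_def by (rule D.char_approx2) (simp add: integrable_distr_eq intk)
    have 1: "D.expectation (\<lambda>x. x ^ k) = expectation (\<lambda>x. V n i x ^ k)" for k
      by (simp add: integral_distr)
    have 2: "(\<Sum>k\<le>2. (\<i> * t) ^ k / fact k * D.expectation (\<lambda>x. x ^ k)) =
        1 + \<i> * (t * e n i) - (t\<^sup>2 * s n i / 2 :: real)"
      unfolding 1 by (simp add: numeral_2_eq_2 e_def s_def prob_space power2_eq_square) (simp add: complex_eq_iff)
    have 3: "D.expectation (\<lambda>x. min (2 * \<bar>x\<bar>\<^sup>2 * Suc 2) (\<bar>t\<bar> * \<bar>x\<bar> ^ Suc 2)) \<le> (6 + \<bar>t\<bar>) * b n i"
    proof -
      have intb: "integrable M (\<lambda>x. min ((V n i x)\<^sup>2) (\<bar>V n i x\<bar> ^ 3))"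
        by (rule Bochner_Integration.integrable_bound[OF sq[OF i]]) auto
      have "D.expectation (\<lambda>x. min (2 * \<bar>x\<bar>\<^sup>2 * Suc 2) (\<bar>t\<bar> * \<bar>x\<bar> ^ Suc 2)) =
          expectation (\<lambda>x. min (6 * (V n i x)\<^sup>2) (\<bar>t\<bar> * \<bar>V n i x\<bar> ^ 3))"
        by (subst integral_distr) (simp_all add: mult.commute)
      also have "\<dots> \<le> expectation (\<lambda>x. (6 + \<bar>t\<bar>) * min ((V n i x)\<^sup>2) (\<bar>V n i x\<bar> ^ 3))"
      proof (rule integral_mono)
        show "integrable M (\<lambda>x. min (6 * (V n i x)\<^sup>2) (\<bar>t\<bar> * \<bar>V n i x\<bar> ^ 3))"
          by (rule Bochner_Integration.integrable_bound[OF integrable_mult_right[OF sq[OF i], of 6]]) auto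
        show "integrable M (\<lambda>x. (6 + \<bar>t\<bar>) * min ((V n i x)\<^sup>2) (\<bar>V n i x\<bar> ^ 3))"
          using intb by simp
        fix x
        let ?a = "(V n i x)\<^sup>2" and ?b = "\<bar>V n i x\<bar> ^ 3"
        have "6 * ?a \<le> (6 + \<bar>t\<bar>) * ?a" "\<bar>t\<bar> * ?b \<le> (6 + \<bar>t\<bar>) * ?b"
          by (intro mult_right_mono; simp)+
        then show "min (6 * ?a) (\<bar>t\<bar> * ?b) \<le> (6 + \<bar>t\<bar>) * min ?a ?b"
          by (auto simp: min_def)
      qed
      also have "\<dots> = (6 + \<bar>t\<bar>) * b n i" by (simp add: b_def)
      finally show ?thesis .
    qed
    from * have "cmod (\<psi> n i - (1 + \<i> * (t * e n i) - (t\<^sup>2 * s n i / 2 :: real))) \<le>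
        t\<^sup>2 / 6 * D.expectation (\<lambda>x. min (2 * \<bar>x\<bar>\<^sup>2 * Suc 2) (\<bar>t\<bar> * \<bar>x\<bar> ^ Suc 2))"
      unfolding 2 by (simp add: eval_nat_numeral)
    also have "\<dots> \<le> t\<^sup>2 / 6 * ((6 + \<bar>t\<bar>) * b n i)"
      by (intro mult_left_mono 3) simp
    finally show ?thesis by (simp add: C_def)
  qed
  have diff: "cmod (char (distr M borel (\<lambda>x. \<Sum>i\<in>I n. V n i x)) t - (\<Prod>i\<in>I n. w n i)) \<le>
      C * (\<Sum>i\<in>I n. b n i) + t\<^sup>2 * (\<Sum>i\<in>I n. (e n i)\<^sup>2) + t ^ 4 / 4 * (\<Sum>i\<in>I n. (s n i)\<^sup>2)" for n
  proof -
    have "char (distr M borel (\<lambda>x. \<Sum>i\<in>I n. V n i x)) t = (\<Prod>i\<in>I n. \<psi> n i)"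
      unfolding \<psi>_def by (rule char_distr_sum[OF indep])
    then have "cmod (char (distr M borel (\<lambda>x. \<Sum>i\<in>I n. V n i x)) t - (\<Prod>i\<in>I n. w n i)) \<le>
        (\<Sum>i\<in>I n. cmod (\<psi> n i - w n i))"
    proof (simp only:, intro norm_prod_diff)
      fix i assume i: "i \<in> I n"
      note [measurable] = rv[OF i]
      show "cmod (\<psi> n i) \<le> 1"
        unfolding \<psi>_def by (rule real_distribution.cmod_char_le_1) simp
      show "cmod (w n i) \<le> 1" using s0[of n i] by (simp add: w_def)
    qed
    also have "\<dots> \<le> (\<Sum>i\<in>I n. C * b n i + t\<^sup>2 * (e n i)\<^sup>2 + t ^ 4 / 4 * (s n i)\<^sup>2)"
    proof (rule sum_mono)
      fix i assume i: "i \<in> I n"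
      have "cmod (\<psi> n i - w n i) \<le> cmod (\<psi> n i - (1 + \<i> * (t * e n i) - (t\<^sup>2 * s n i / 2 :: real)))
          + cmod (w n i - (1 + \<i> * (t * e n i) - (t\<^sup>2 * s n i / 2 :: real)))"
        by (rule norm_triangle_le_diff[OF order_refl, THEN order_trans[rotated]]) simp
      also have "cmod (w n i - (1 + \<i> * (t * e n i) - (t\<^sup>2 * s n i / 2 :: real))) \<le> (t * e n i)\<^sup>2 + (t\<^sup>2 * s n i / 2)\<^sup>2"
        unfolding w_def by (rule norm_exp_minus_linear_le) (simp add: s0)
      also have "\<dots> = t\<^sup>2 * (e n i)\<^sup>2 + t ^ 4 / 4 * (s n i)\<^sup>2"
        by (simp add: power_mult_distrib power_divide)
      finally show "cmod (\<psi> n i - w n i) \<le> C * b n i + t\<^sup>2 * (e n i)\<^sup>2 + t ^ 4 / 4 * (s n i)\<^sup>2"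
        using psi[OF i] by simp
    qed
    finally show ?thesis by (simp add: sum.distrib sum_distrib_left)
  qed
  have "(\<lambda>n. C * (\<Sum>i\<in>I n. b n i) + t\<^sup>2 * (\<Sum>i\<in>I n. (e n i)\<^sup>2) + t ^ 4 / 4 * (\<Sum>i\<in>I n. (s n i)\<^sup>2))
      \<longlonglongrightarrow> 0"
    using mean_sq var_sq lindeberg unfolding b_def e_def s_def by (auto intro!: tendsto_eq_intros)
  then have lim: "(\<lambda>n. char (distr M borel (\<lambda>x. \<Sum>i\<in>I n. V n i x)) t - (\<Prod>i\<in>I n. w n i)) \<longlonglongrightarrow> 0"
    by (rule Lim_null_comparison[OF always_eventually, rotated]) (intro allI diff)
  have "(\<Prod>i\<in>I n. w n i) = exp (\<i> * complex_of_real (t * (\<Sum>i\<in>I n. e n i)) - complex_of_real (t\<^sup>2 * (\<Sum>i\<in>I n. s n i) / 2))" for n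
    unfolding w_def by (simp add: exp_sum[symmetric] fin sum_subtractf sum_distrib_left sum_divide_distrib)
  moreover have "(\<lambda>n. exp (\<i> * complex_of_real (t * (\<Sum>i\<in>I n. e n i)) - complex_of_real (t\<^sup>2 * (\<Sum>i\<in>I n. s n i) / 2)))
      \<longlonglongrightarrow> exp (\<i> * complex_of_real (t * m) - complex_of_real (t\<^sup>2 * v / 2))"
    using mean var unfolding e_def s_def by (intro tendsto_intros) auto
  ultimately have "(\<lambda>n. \<Prod>i\<in>I n. w n i) \<longlonglongrightarrow> exp (\<i> * complex_of_real (t * m) - complex_of_real (t\<^sup>2 * v / 2))"
    by simp
  from tendsto_add[OF lim this] show ?thesis by (simp add: mult.commute)
qed

text \<open>Slutsky's theorem with second moments in place of convergence in probability: the
  characteristic functions of \<open>W n\<close> and \<open>S n / d\<close> are compared under the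
  expectation, and Cauchy-Schwarz separates \<open>S n\<close> from \<open>D n - d\<close>. Points
  with \<open>D n x = 0\<close>, where \<open>W\<close> is unconstrained, are far from
  \<open>d\<close> and hence negligible.\<close>

lemma (in prob_space) weak_conv_ratio:
  fixes S D W :: "nat \<Rightarrow> 'a \<Rightarrow> real"
  assumes W[measurable]: "\<And>n. random_variable borel (W n)"
    and S[measurable]: "\<And>n. random_variable borel (S n)"
    and D[measurable]: "\<And>n. random_variable borel (D n)"
    and S2: "\<And>n. integrable M (\<lambda>x. (S n x)\<^sup>2)"
    and D2: "\<And>n. integrable M (\<lambda>x. (D n x - d)\<^sup>2)"
    and bound: "Bseq (\<lambda>n. expectation (\<lambda>x. (S n x)\<^sup>2))"
    and D_lim: "(\<lambda>n. expectation (\<lambda>x. (D n x - d)\<^sup>2)) \<longlonglongrightarrow> 0"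
    and d: "d > 0"
    and ratio: "\<And>n x. x \<in> space M \<Longrightarrow> D n x \<noteq> 0 \<Longrightarrow> W n x = S n x / D n x"
    and \<mu>: "real_distribution \<mu>"
    and char_lim: "\<And>t. (\<lambda>n. char (distr M borel (S n)) (t / d)) \<longlonglongrightarrow> char \<mu> t"
  shows "weak_conv_m (\<lambda>n. distr M borel (W n)) \<mu>"
proof (rule levy_continuity)
  show "real_distribution (distr M borel (W n))" for n by simp
  show "real_distribution \<mu>" by fact
  fix t :: real
  obtain B where B: "\<And>n. expectation (\<lambda>x. (S n x)\<^sup>2) \<le> B"
    using bound by (auto simp: Bseq_def abs_le_iff)
  define u where "u n = expectation (\<lambda>x. (D n x - d)\<^sup>2)" for n
  have u0: "u n \<ge> 0" for n by (simp add: u_def)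
  have diff: "cmod (char (distr M borel (W n)) t - char (distr M borel (S n)) (t / d)) \<le>
      2 * \<bar>t\<bar> / d\<^sup>2 * sqrt (B * u n) + 8 / d\<^sup>2 * u n" for n
  proof -
    have int: "integrable M (\<lambda>x. \<bar>S n x\<bar> * \<bar>D n x - d\<bar>)"
      by (rule square_expectation_mult_le) (use S2 D2 in simp_all)
    have i1: "integrable M (\<lambda>x. iexp (t * W n x))" "integrable M (\<lambda>x. iexp (t / d * S n x))"
      by (rule integrable_iexp; simp)+
    have "char (distr M borel (W n)) t - char (distr M borel (S n)) (t / d) =
        (CLINT x|M. iexp (t * W n x) - iexp (t / d * S n x))"
      using i1 by (simp add: char_def integral_distr)
    also have "cmod \<dots> \<le> expectation (\<lambda>x. cmod (iexp (t * W n x) - iexp (t / d * S n x)))"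
      by (rule integral_norm_bound)
    also have "\<dots> \<le> expectation (\<lambda>x. 2 * \<bar>t\<bar> / d\<^sup>2 * (\<bar>S n x\<bar> * \<bar>D n x - d\<bar>) + 8 / d\<^sup>2 * (D n x - d)\<^sup>2)"
    proof (rule integral_mono)
      show "integrable M (\<lambda>x. cmod (iexp (t * W n x) - iexp (t / d * S n x)))"
        using i1 by simp
      show "integrable M (\<lambda>x. 2 * \<bar>t\<bar> / d\<^sup>2 * (\<bar>S n x\<bar> * \<bar>D n x - d\<bar>) + 8 / d\<^sup>2 * (D n x - d)\<^sup>2)"
        using int D2 by simp
      fix x assume x: "x \<in> space M"
      show "cmod (iexp (t * W n x) - iexp (t / d * S n x)) \<le>
          2 * \<bar>t\<bar> / d\<^sup>2 * (\<bar>S n x\<bar> * \<bar>D n x - d\<bar>) + 8 / d\<^sup>2 * (D n x - d)\<^sup>2"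
      \<comment> \<open>Near \<open>d\<close> the quotient is within a multiple of
        \<open>\<bar>S n x\<bar> * \<bar>D n x - d\<bar>\<close> of \<open>S n x / d\<close>. Away
        from \<open>d\<close> the trivial bound 2 is charged to the squared deviation, as in
        Chebyshev's inequality.\<close>
      proof (cases "\<bar>D n x - d\<bar> \<le> d / 2")
        case True
        then have Dx: "D n x \<ge> d / 2" by (simp add: abs_if split: if_splits)
        then have Dp: "D n x > 0" using d by simp
        have "t * W n x - t / d * S n x = t * S n x * (d - D n x) / (D n x * d)"
          using ratio[OF x, of n] Dp d by (simp add: field_simps)
        then have "\<bar>t * W n x - t / d * S n x\<bar> = \<bar>t\<bar> * (\<bar>S n x\<bar> * \<bar>D n x - d\<bar>) / (D n x * d)"
          using Dp d by (simp add: abs_mult abs_minus_commute)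
        also have "\<dots> \<le> \<bar>t\<bar> * (\<bar>S n x\<bar> * \<bar>D n x - d\<bar>) / (d / 2 * d)"
          using Dx Dp d by (intro divide_left_mono mult_right_mono mult_pos_pos) auto
        also have "\<dots> = 2 * \<bar>t\<bar> / d\<^sup>2 * (\<bar>S n x\<bar> * \<bar>D n x - d\<bar>)"
          by (simp add: power2_eq_square)
        finally have "cmod (iexp (t * W n x) - iexp (t / d * S n x)) \<le> 2 * \<bar>t\<bar> / d\<^sup>2 * (\<bar>S n x\<bar> * \<bar>D n x - d\<bar>)"
          using norm_iexp_diff_le[of "t * W n x" "t / d * S n x"] by linarith
        then show ?thesis by (rule order_trans) simp
      next
        case False
        then have "(d / 2)\<^sup>2 \<le> (D n x - d)\<^sup>2"
          using d by (simp add: abs_le_square_iff[symmetric])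
        then have "2 \<le> 8 / d\<^sup>2 * (D n x - d)\<^sup>2" using d by (simp add: field_simps power_divide)
        moreover have "cmod (iexp (t * W n x) - iexp (t / d * S n x)) \<le> 2"
          by (rule order_trans[OF norm_triangle_ineq4]) simp
        moreover have "0 \<le> 2 * \<bar>t\<bar> / d\<^sup>2 * (\<bar>S n x\<bar> * \<bar>D n x - d\<bar>)" by simp
        ultimately show ?thesis by linarith
      qed
    qed
    also have "\<dots> = 2 * \<bar>t\<bar> / d\<^sup>2 * expectation (\<lambda>x. \<bar>S n x\<bar> * \<bar>D n x - d\<bar>) + 8 / d\<^sup>2 * u n"
      using int D2 by (simp add: u_def)
    also have "\<dots> \<le> 2 * \<bar>t\<bar> / d\<^sup>2 * sqrt (B * u n) + 8 / d\<^sup>2 * u n"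
    proof (intro add_right_mono mult_left_mono real_le_rsqrt)
      have "(expectation (\<lambda>x. \<bar>S n x\<bar> * \<bar>D n x - d\<bar>))\<^sup>2 \<le> expectation (\<lambda>x. \<bar>S n x\<bar>\<^sup>2) * expectation (\<lambda>x. \<bar>D n x - d\<bar>\<^sup>2)"
        by (rule square_expectation_mult_le) (use S2 D2 in simp_all)
      also have "\<dots> \<le> B * u n" using B[of n] u0[of n] by (simp add: u_def mult_right_mono)
      finally show "(expectation (\<lambda>x. \<bar>S n x\<bar> * \<bar>D n x - d\<bar>))\<^sup>2 \<le> B * u n" .
    qed simp
    finally show ?thesis .
  qed
  have "(\<lambda>n. 2 * \<bar>t\<bar> / d\<^sup>2 * sqrt (B * u n) + 8 / d\<^sup>2 * u n) \<longlonglongrightarrow> 0"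
    using D_lim d unfolding u_def by (auto intro!: tendsto_eq_intros)
  then have "(\<lambda>n. char (distr M borel (W n)) t - char (distr M borel (S n)) (t / d)) \<longlonglongrightarrow> 0"
    by (rule Lim_null_comparison[OF always_eventually, rotated]) (intro allI diff)
  from tendsto_add[OF this char_lim[of t]]
  show "(\<lambda>n. char (distr M borel (W n)) t) \<longlonglongrightarrow> char \<mu> t" by simp
qed

text \<open>The limiting variance may vanish, for instance when \<open>\<sigma>2 chi = 0\<close>,
  hence the separate case of a point mass. Otherwise the law is an affine image of the standard
  normal law.\<close>

lemma
  assumes "v \<ge> 0"
  shows real_distribution_normal_law: "real_distribution (normal_law m v)"
    and char_normal_law: "char (normal_law m v) t = exp (\<i> * (m * t) - v * t\<^sup>2 / 2)"
proof -
  have "real_distribution (normal_law m v) \<and> char (normal_law m v) t = exp (\<i> * (m * t) - v * t\<^sup>2 / 2)"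
  proof (cases "v = 0")
    case True
    have "real_distribution (return borel m)"
      by (auto simp: real_distribution_def real_distribution_axioms_def prob_space_return)
    then show ?thesis using True
      by (simp add: normal_law_def char_def integral_return mult.commute)
  next
    case False
    with assms have s: "0 < sqrt v" by simp
    interpret N: prob_space std_normal_distribution
      by (rule prob_space_normal_density) simp
    have "distributed std_normal_distribution lborel (\<lambda>x. x) std_normal_density"
      unfolding distributed_def by (simp add: distr_id2)
    from N.normal_density_affine[OF this, of "sqrt v" m] s
    have *: "distr std_normal_distribution lborel (\<lambda>x. m + sqrt v * x) = density lborel (normal_density m (sqrt v))"
      by (simp add: distributed_def)
    have d: "normal_law m v = distr std_normal_distribution borel (\<lambda>x. m + sqrt v * x)"
      using False * by (simp add: normal_law_def cong: distr_cong)
    have "real_distribution (normal_law m v)"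
      unfolding d by (rule N.real_distribution_distr) simp
    moreover have "char (normal_law m v) t = (CLINT x|std_normal_distribution. iexp (t * m) * iexp (t * sqrt v * x))"
      unfolding d char_def by (subst integral_distr) (auto simp: algebra_simps exp_add)
    moreover have "\<dots> = iexp (t * m) * char std_normal_distribution (t * sqrt v)"
      unfolding char_def by (rule integral_mult_right_zero)
    moreover have "\<dots> = exp (\<i> * (m * t) - v * t\<^sup>2 / 2)"
    proof -
      have "(t * sqrt v)\<^sup>2 = v * t\<^sup>2" using assms by (simp add: power_mult_distrib)
      moreover have "exp (\<i> * (m * t) - v * t\<^sup>2 / 2) = iexp (t * m) * complex_of_real (exp (- (v * t\<^sup>2) / 2))"
        unfolding exp_of_real[symmetric] exp_add[symmetric] by (simp add: mult.commute)
      ultimately show ?thesis by (simp only: char_std_normal_distribution)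
    qed
    ultimately show ?thesis by simp
  qed
  then show "real_distribution (normal_law m v)" "char (normal_law m v) t = exp (\<i> * (m * t) - v * t\<^sup>2 / 2)"
    by simp_all
qed

subsection \<open>One-sided derivatives on the unit interval\<close>

lemma has_vector_derivative_deriv01:
  assumes "G differentiable (at s within {0..1})" "s \<in> {0..1}"
  shows "(G has_vector_derivative deriv01 G s) (at s within {0..1})"
  using assms unfolding deriv01_def by (simp add: vector_derivative_works)

lemma deriv01_unique:
  assumes "(G has_real_derivative g) (at s within {0..1})" "s \<in> {0..1}"
  shows "deriv01 G s = g"
  unfolding deriv01_def
  using vector_derivative_within_cbox[where f=G and f'=g and x=s and a=0 and b=1] assms
  by (simp add: has_real_derivative_iff_has_vector_derivative)

text \<open>The fundamental theorem for the gauge integral asks only that the derivative exist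
  everywhere, not that it be continuous. Lebesgue integrability then identifies the two
  integrals.\<close>

lemma deriv01_integral:
  assumes diff: "\<And>s. s \<in> {0..1} \<Longrightarrow> G differentiable (at s within {0..1})"
    and int: "set_integrable lborel {0..1} (deriv01 G)"
    and u: "u \<in> {0..1}"
  shows "(LBINT s:{u..1}. deriv01 G s) = G 1 - G u"
proof -
  have "(deriv01 G has_integral (G 1 - G u)) {u..1}"
  proof (rule fundamental_theorem_of_calculus)
    fix s assume "s \<in> {u..1}"
    then have "s \<in> {0..1}" using u by auto
    from has_vector_derivative_deriv01[OF diff[OF this] this]
    show "(G has_vector_derivative deriv01 G s) (at s within {u..1})"
      by (rule has_vector_derivative_within_subset) (use u in auto)
  qed (use u in auto)
  moreover have "set_integrable lborel {u..1} (deriv01 G)"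
    by (rule set_integrable_subset[OF int]) (use u in auto)
  ultimately show ?thesis
    using set_borel_integral_eq_integral(2) by (metis integral_unique)
qed

text \<open>The kernel may jump at both ends of its support, so its measurability cannot come from
  continuity on the whole line.\<close>

lemma continuous_on_imp_measurable_supported:
  fixes G :: "real \<Rightarrow> real"
  assumes "continuous_on {0..1} G" "\<And>s. s \<notin> {0..1} \<Longrightarrow> G s = 0"
  shows "G \<in> borel_measurable borel"
proof -
  have "(\<lambda>s. indicator {0..1} s *\<^sub>R G s) \<in> borel_measurable borel"
    by (rule borel_measurable_continuous_on_indicator) (use assms in auto)
  moreover have "(\<lambda>s. indicator {0..1} s *\<^sub>R G s) = G"
    using assms(2) by (auto simp: indicator_def fun_eq_iff)
  ultimately show ?thesis by simp
qed

lemma set_integrable_mult_continuous: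
  fixes G g :: "real \<Rightarrow> real"
  assumes G: "continuous_on {a..b} G" and g: "set_integrable lborel {a..b} g"
  shows "set_integrable lborel {a..b} (\<lambda>s. G s * g s)"
proof -
  have "bounded (G ` {a..b})" using G by (intro compact_imp_bounded compact_continuous_image) auto
  then obtain B where "\<forall>y\<in>G ` {a..b}. norm y \<le> B"
    unfolding bounded_iff by blast
  then have B: "\<bar>G s\<bar> \<le> B" if "s \<in> {a..b}" for s using that by simp
  have "(\<lambda>s. indicator {a..b} s *\<^sub>R G s) \<in> borel_measurable borel"
    by (rule borel_measurable_continuous_on_indicator) (use G in auto)
  then have m: "(\<lambda>s. (indicator {a..b} s *\<^sub>R G s) * (indicator {a..b} s *\<^sub>R g s)) \<in> borel_measurable lborel"
    using g by (intro borel_measurable_times) (auto simp: set_integrable_def)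
  have "integrable lborel (\<lambda>s. (indicator {a..b} s *\<^sub>R G s) * (indicator {a..b} s *\<^sub>R g s))"
  proof (rule Bochner_Integration.integrable_bound[OF _ m])
    show "integrable lborel (\<lambda>s. B * (indicator {a..b} s *\<^sub>R g s))"
      using g unfolding set_integrable_def by (rule integrable_mult_right)
    have "\<bar>G s\<bar> * \<bar>g s\<bar> \<le> \<bar>B\<bar> * \<bar>g s\<bar>" if "s \<in> {a..b}" for s
      using B[OF that] by (intro mult_right_mono) auto
    then show "AE s in lborel. norm ((indicator {a..b} s *\<^sub>R G s) * (indicator {a..b} s *\<^sub>R g s)) \<le>
        norm (B * (indicator {a..b} s *\<^sub>R g s))"
      by (auto simp: indicator_def abs_mult)
  qed
  moreover have "(indicator {a..b} s *\<^sub>R G s) * (indicator {a..b} s *\<^sub>R g s) = indicator {a..b} s *\<^sub>R (G s * g s)" for s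
    by (simp add: indicator_def)
  ultimately show ?thesis unfolding set_integrable_def by (simp only:)
qed

lemma differentiable01_continuous_on:
  fixes G :: "real \<Rightarrow> real"
  assumes "\<And>s. s \<in> {0..1} \<Longrightarrow> G differentiable (at s within {0..1})"
  shows "continuous_on {0..1} G"
  using assms by (auto simp: continuous_on_eq_continuous_within intro: differentiable_imp_continuous_within)

text \<open>Applied to \<open>s * K s\<close> and \<open>K s * K s\<close>, it passes integrability
  from the derivative of \<open>K\<close> to the derivatives in \<open>M0\<close> and
  \<open>M2\<close>.\<close>

lemma deriv01_mult_integrable:
  fixes G H :: "real \<Rightarrow> real"
  assumes G: "\<And>s. s \<in> {0..1} \<Longrightarrow> G differentiable (at s within {0..1})" "set_integrable lborel {0..1} (deriv01 G)"
    and H: "\<And>s. s \<in> {0..1} \<Longrightarrow> H differentiable (at s within {0..1})" "set_integrable lborel {0..1} (deriv01 H)"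
  shows "set_integrable lborel {0..1} (deriv01 (\<lambda>s. G s * H s))"
proof -
  have eq: "deriv01 (\<lambda>s. G s * H s) s = H s * deriv01 G s + G s * deriv01 H s" if s: "s \<in> {0..1}" for s
  proof (rule deriv01_unique[OF _ s])
    have "(G has_real_derivative deriv01 G s) (at s within {0..1})" "(H has_real_derivative deriv01 H s) (at s within {0..1})"
      using has_vector_derivative_deriv01 G(1) H(1) s by (simp_all add: has_real_derivative_iff_has_vector_derivative)
    from DERIV_mult'[OF this] show "((\<lambda>s. G s * H s) has_real_derivative H s * deriv01 G s + G s * deriv01 H s) (at s within {0..1})"
      by (simp add: algebra_simps)
  qed
  have "set_integrable lborel {0..1} (\<lambda>s. H s * deriv01 G s + G s * deriv01 H s)"
    by (intro set_integral_add set_integrable_mult_continuous differentiable01_continuous_on G H)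
  then show ?thesis
    by (subst set_integrable_cong[OF refl refl]) (auto simp: eq)
qed

lemma deriv01_id_integrable: "set_integrable lborel {0..1} (deriv01 (\<lambda>s. s))"
proof -
  have "deriv01 (\<lambda>s. s) s = 1" if "s \<in> {0..1}" for s
    by (rule deriv01_unique[OF _ that]) (rule DERIV_ident)
  then show ?thesis
    by (subst set_integrable_cong[OF refl refl, where f'="\<lambda>_. 1"]) (auto simp: set_integrable_def)
qed

subsection \<open>Conditional expectations and exponential moments\<close>

text \<open>The only access to the almost sure identity inside \<open>cond_exp_given\<close>: all
  later conditioning is done by testing against functions of \<open>X\<close>.\<close>

lemma cond_exp_given_integral:
  assumes M: "prob_space M" and ce: "cond_exp_given M X V g"
    and X: "X \<in> borel_measurable M" and f: "f \<in> borel_measurable borel"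
    and int: "integrable M (\<lambda>x. f (X x) * V x)"
  shows "(\<integral>x. f (X x) * V x \<partial>M) = (\<integral>x. f (X x) * g (X x) \<partial>M)"
proof -
  interpret prob_space M by fact
  define A where "A = vimage_algebra (space M) X borel"
  interpret finite_measure_subalgebra M A
  proof
    have "sets A \<subseteq> sets M"
      unfolding A_def by (intro sets_image_in_sets) (use X in auto)
    then show "subalgebra M A"
      by (simp add: subalgebra_def A_def)
  qed
  have "X \<in> measurable A borel"
    unfolding A_def by (rule measurable_vimage_algebra1) simp
  then have fX: "(\<lambda>x. f (X x)) \<in> borel_measurable A"
    by (rule measurable_compose[OF _ f])
  have V: "V \<in> borel_measurable M" and g: "g \<in> borel_measurable borel"
    and AE: "AE x in M. real_cond_exp M A V x = g (X x)"
    using ce by (auto simp: cond_exp_given_def A_def)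
  note [measurable] = X f g
  have AE': "AE x in M. f (X x) * real_cond_exp M A V x = f (X x) * g (X x)"
    using AE by eventually_elim simp
  have m: "(\<lambda>x. f (X x) * real_cond_exp M A V x) \<in> borel_measurable M"
    using borel_measurable_cond_exp2 by measurable
  show "(\<integral>x. f (X x) * V x \<partial>M) = (\<integral>x. f (X x) * g (X x) \<partial>M)"
    using real_cond_exp_intg(2)[OF int fX V] integral_cong_AE[OF m _ AE'] by simp
qed

text \<open>The exponent is split in half. One half of \<open>lam\<close> dominates the square; on
  the event that \<open>\<bar>Y x\<bar>\<close> exceeds \<open>b\<close>, the other half yields the
  decaying factor.\<close>

lemma (in prob_space) exp_moment_tail:
  fixes Y :: "'a \<Rightarrow> real"
  assumes Y[measurable]: "random_variable borel Y"
    and lam: "0 < lam" and mu: "0 < \<mu>"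
    and int: "integrable M (\<lambda>x. exp (lam * \<bar>Y x\<bar> powr \<mu>))"
  shows "integrable M (\<lambda>x. (Y x - a)\<^sup>2)"
    and "\<exists>C. \<forall>b\<ge>0. expectation (\<lambda>x. (Y x - a)\<^sup>2 * indicator {b<..} \<bar>Y x\<bar>) \<le> C * exp (- (lam / 2) * b powr \<mu>)"
proof -
  \<comment> \<open>Chosen so that \<open>(\<bar>y\<bar> powr \<mu>) powr s\<close> is the square of
    \<open>y\<close>.\<close>
  define s where "s = 2 / \<mu>"
  have s: "s > 0" using mu by (simp add: s_def)
  \<comment> \<open>This comes from raising \<open>x / s \<le> exp (x / s)\<close> to the power
    \<open>s\<close>, with \<open>x = lam / 2 * \<bar>y\<bar> powr \<mu>\<close>.\<close>
  define C1 where "C1 = s powr s / (lam / 2) powr s"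
  have C1: "C1 \<ge> 0" by (simp add: C1_def)
  have sq: "y\<^sup>2 \<le> C1 * exp (lam / 2 * \<bar>y\<bar> powr \<mu>)" for y :: real
  proof (cases "y = 0")
    case False
    define x where "x = lam / 2 * \<bar>y\<bar> powr \<mu>"
    have x: "x > 0" using lam False by (simp add: x_def)
    have "x / s \<le> exp (x / s)" using exp_ge_add_one_self[of "x / s"] by linarith
    then have "(x / s) powr s \<le> exp (x / s) powr s" using x s by (intro powr_mono2) auto
    also have "\<dots> = exp x" using s by (simp add: powr_def)
    finally have "x powr s \<le> s powr s * exp x"
      using x s by (simp add: powr_divide field_simps)
    moreover have "x powr s = (lam / 2) powr s * y\<^sup>2"
    proof -
      have "(\<bar>y\<bar> powr \<mu>) powr s = \<bar>y\<bar> powr 2" using mu by (simp add: powr_powr s_def)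
      also have "\<dots> = y\<^sup>2" using False by simp
      finally show ?thesis using lam unfolding x_def by (subst powr_mult) auto
    qed
    ultimately show ?thesis using lam
      by (simp add: C1_def x_def field_simps)
  qed (use C1 in simp)
  define C where "C = 2 * C1 + 2 * a\<^sup>2"
  have C: "C \<ge> 0" using C1 by (simp add: C_def)
  have sqa: "(y - a)\<^sup>2 \<le> C * exp (lam / 2 * \<bar>y\<bar> powr \<mu>)" for y
  proof -
    have "0 \<le> (y + a)\<^sup>2" by simp
    then have "(y - a)\<^sup>2 \<le> 2 * y\<^sup>2 + 2 * a\<^sup>2" by (simp add: power2_eq_square algebra_simps)
    also have "\<dots> \<le> 2 * (C1 * exp (lam / 2 * \<bar>y\<bar> powr \<mu>)) + 2 * a\<^sup>2 * exp (lam / 2 * \<bar>y\<bar> powr \<mu>)"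
      using sq[of y] lam mult_left_mono[of 1 "exp (lam / 2 * \<bar>y\<bar> powr \<mu>)" "2 * a\<^sup>2"] by (intro add_mono) auto
    finally show ?thesis by (simp add: C_def algebra_simps)
  qed
  show int2: "integrable M (\<lambda>x. (Y x - a)\<^sup>2)"
  proof (rule Bochner_Integration.integrable_bound)
    show "integrable M (\<lambda>x. C * exp (lam * \<bar>Y x\<bar> powr \<mu>))" using int by simp
    have "(Y x - a)\<^sup>2 \<le> C * exp (lam * \<bar>Y x\<bar> powr \<mu>)" for x
    proof (rule order_trans[OF sqa mult_left_mono])
      show "exp (lam / 2 * \<bar>Y x\<bar> powr \<mu>) \<le> exp (lam * \<bar>Y x\<bar> powr \<mu>)"
        using lam by simp
    qed fact
    then show "AE x in M. norm ((Y x - a)\<^sup>2) \<le> norm (C * exp (lam * \<bar>Y x\<bar> powr \<mu>))"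
      using C by simp
  qed simp
  show "\<exists>C. \<forall>b\<ge>0. expectation (\<lambda>x. (Y x - a)\<^sup>2 * indicator {b<..} \<bar>Y x\<bar>) \<le> C * exp (- (lam / 2) * b powr \<mu>)"
  proof (intro exI allI impI)
    fix b :: real assume b: "b \<ge> 0"
    have "expectation (\<lambda>x. (Y x - a)\<^sup>2 * indicator {b<..} \<bar>Y x\<bar>) \<le>
        expectation (\<lambda>x. C * exp (- (lam / 2) * b powr \<mu>) * exp (lam * \<bar>Y x\<bar> powr \<mu>))"
    proof (rule integral_mono)
      show "integrable M (\<lambda>x. (Y x - a)\<^sup>2 * indicator {b<..} \<bar>Y x\<bar>)"
        by (rule Bochner_Integration.integrable_bound[OF int2]) (auto simp: indicator_def)
      show "integrable M (\<lambda>x. C * exp (- (lam / 2) * b powr \<mu>) * exp (lam * \<bar>Y x\<bar> powr \<mu>))"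
        using int by simp
      fix x
      show "(Y x - a)\<^sup>2 * indicator {b<..} \<bar>Y x\<bar> \<le> C * exp (- (lam / 2) * b powr \<mu>) * exp (lam * \<bar>Y x\<bar> powr \<mu>)"
      proof (cases "b < \<bar>Y x\<bar>")
        case True
        then have "b powr \<mu> \<le> \<bar>Y x\<bar> powr \<mu>" using b mu by (intro powr_mono2) auto
        then have "lam / 2 * b powr \<mu> \<le> lam / 2 * \<bar>Y x\<bar> powr \<mu>"
          using lam by simp
        then have "lam / 2 * \<bar>Y x\<bar> powr \<mu> \<le> - (lam / 2) * b powr \<mu> + lam * \<bar>Y x\<bar> powr \<mu>"
          by (simp add: field_simps)
        then have "exp (lam / 2 * \<bar>Y x\<bar> powr \<mu>) \<le> exp (- (lam / 2) * b powr \<mu>) * exp (lam * \<bar>Y x\<bar> powr \<mu>)"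
          by (simp flip: exp_add)
        from order_trans[OF sqa mult_left_mono[OF this C]] True show ?thesis by (simp add: mult.assoc)
      qed (use C in simp)
    qed
    also have "\<dots> = (C * expectation (\<lambda>x. exp (lam * \<bar>Y x\<bar> powr \<mu>))) * exp (- (lam / 2) * b powr \<mu>)"
      by simp
    finally show "expectation (\<lambda>x. (Y x - a)\<^sup>2 * indicator {b<..} \<bar>Y x\<bar>) \<le> \<dots>" .
  qed
qed

subsection \<open>Kernel moments over small balls\<close>

text \<open>The kernel sees an observation only through its distance to \<open>chi\<close>. Working
  with this real variable \<open>Z\<close> and its distribution function \<open>F\<close> removes
  the Banach space from the moment computations.\<close>

locale small_ball = prob_space M for M :: "'w measure" +
  fixes Z :: "'w \<Rightarrow> real" and F :: "real \<Rightarrow> real"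
  assumes Z_measurable[measurable]: "random_variable borel Z"
    and Z_nonneg: "\<And>x. x \<in> space M \<Longrightarrow> 0 \<le> Z x"
    and F_eq: "\<And>t. F t = prob {x \<in> space M. Z x \<le> t}"
    and F_pos: "\<And>t. 0 < t \<Longrightarrow> 0 < F t"
begin

lemma F_nonneg: "0 \<le> F t" and F_le_1: "F t \<le> 1"
  by (simp_all add: F_eq)

lemma F_mono: "s \<le> t \<Longrightarrow> F s \<le> F t"
  unfolding F_eq by (intro finite_measure_mono) auto

lemma F_eq_expectation: "F t = expectation (\<lambda>x. indicator {..t} (Z x))"
proof -
  have "expectation (\<lambda>x. indicator {..t} (Z x) :: real) = expectation (indicator {x \<in> space M. Z x \<le> t})"
    by (intro Bochner_Integration.integral_cong) (auto simp: indicator_def)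
  then show ?thesis by (simp add: F_eq)
qed

lemma F_measurable[measurable]: "F \<in> borel_measurable borel"
  by (rule borel_measurable_mono) (simp add: mono_def F_mono)

lemma expectation_kernel:
  assumes diff: "\<And>s. s \<in> {0..1} \<Longrightarrow> G differentiable (at s within {0..1})"
    and int: "set_integrable lborel {0..1} (deriv01 G)"
    and supp: "\<And>s. s \<notin> {0..1} \<Longrightarrow> G s = 0"
    and h: "0 < h"
  shows "expectation (\<lambda>x. G (Z x / h)) = G 1 * F h - (LBINT s:{0..1}. deriv01 G s * F (h * s))"
proof -
  interpret P: pair_sigma_finite M lborel ..
  define g where "g s = indicator {0..1} s *\<^sub>R deriv01 G s" for s
  have g: "integrable lborel g" using int unfolding set_integrable_def g_def .
  then have [measurable]: "g \<in> borel_measurable borel" by simp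
  \<comment> \<open>Integrated over \<open>s\<close> first, this gives the increment of
    \<open>G\<close> from \<open>Z x / h\<close> to 1 when \<open>Z x \<le> h\<close>; integrated
    over \<open>x\<close> first, it gives \<open>F (h * s)\<close>. Fubini equates the two.\<close>
  define f where "f x s = g s * (if Z x \<le> h * s then 1 else 0)" for x s
  have f_le: "\<bar>f x s\<bar> \<le> \<bar>g s\<bar>" for x s by (simp add: f_def)
  have fx: "integrable lborel (f x)" if "x \<in> space M" for x
    unfolding f_def by (rule Bochner_Integration.integrable_bound[OF g]) auto
  have f[measurable]: "case_prod f \<in> borel_measurable (M \<Otimes>\<^sub>M lborel)"
    unfolding f_def by measurable
  have f_int: "integrable (M \<Otimes>\<^sub>M lborel) (case_prod f)"
  proof (rule P.Fubini_integrable[OF f])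
    show "integrable M (\<lambda>x. LBINT s. norm (case (x, s) of (x, s) \<Rightarrow> f x s))"
    proof (rule integrable_const_bound)
      show "AE x in M. norm (LBINT s. norm (case (x, s) of (x, s) \<Rightarrow> f x s)) \<le> (LBINT s. \<bar>g s\<bar>)"
        using fx g f_le by (auto intro!: AE_I2 integral_mono)
    qed measurable
    show "AE x in M. integrable lborel (\<lambda>s. case (x, s) of (x, s) \<Rightarrow> f x s)"
      using fx by (auto intro!: AE_I2)
  qed
  have point: "G (Z x / h) = G 1 * indicator {..h} (Z x) - (LBINT s. f x s)" if x: "x \<in> space M" for x
  proof (cases "Z x \<le> h")
    case True
    then have u: "Z x / h \<in> {0..1}" using Z_nonneg[OF x] h by simp
    have "f x s = indicator {Z x / h..1} s *\<^sub>R deriv01 G s" for s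
    proof -
      have "Z x \<le> h * s \<longleftrightarrow> Z x / h \<le> s" using h by (simp add: field_simps)
      then show ?thesis using u by (auto simp: f_def g_def indicator_def)
    qed
    then have "(LBINT s. f x s) = (LBINT s:{Z x / h..1}. deriv01 G s)"
      by (simp add: set_lebesgue_integral_def)
    also have "\<dots> = G 1 - G (Z x / h)" by (rule deriv01_integral[OF diff int u])
    finally show ?thesis using True by simp
  next
    case False
    have "f x s = 0" for s
    proof (cases "s \<in> {0..1}")
      case True
      then have "h * s \<le> h" using h by simp
      with False show ?thesis by (simp add: f_def)
    qed (simp add: f_def g_def)
    moreover have "G (Z x / h) = 0" using False h by (intro supp) (auto simp: field_simps)
    ultimately show ?thesis using False by simp
  qed
  have "expectation (\<lambda>x. G (Z x / h)) = expectation (\<lambda>x. G 1 * indicator {..h} (Z x) - (LBINT s. f x s))"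
    by (intro Bochner_Integration.integral_cong) (auto simp: point)
  also have "\<dots> = G 1 * F h - expectation (\<lambda>x. LBINT s. f x s)"
  proof (subst Bochner_Integration.integral_diff)
    show "integrable M (\<lambda>x. G 1 * indicator {..h} (Z x))"
      by (intro integrable_mult_right integrable_const_bound[where B=1]) (auto simp: indicator_def)
    show "integrable M (\<lambda>x. LBINT s. f x s)" using P.integrable_fst[OF f_int] .
  qed (simp add: F_eq_expectation)
  also have "expectation (\<lambda>x. LBINT s. f x s) = (LBINT s. expectation (\<lambda>x. f x s))"
    by (rule P.Fubini_integral[OF f_int, symmetric])
  also have "\<dots> = (LBINT s. g s * F (h * s))"
  proof (rule Bochner_Integration.integral_cong[OF refl])
    fix s
    have "expectation (\<lambda>x. f x s) = expectation (\<lambda>x. g s * indicator {..h * s} (Z x))"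
      by (intro Bochner_Integration.integral_cong) (auto simp: f_def)
    then show "expectation (\<lambda>x. f x s) = g s * F (h * s)" by (simp add: F_eq_expectation)
  qed
  also have "(LBINT s. g s * F (h * s)) = (LBINT s:{0..1}. deriv01 G s * F (h * s))"
    by (simp add: set_lebesgue_integral_def g_def mult.assoc)
  finally show ?thesis .
qed

text \<open>Dominated convergence: since \<open>F\<close> is nondecreasing, the ratios
  \<open>F (t * s) / F t\<close> lie in the unit interval for \<open>s\<close> in
  \<open>{0..1}\<close>, so the derivative itself is the dominating function.\<close>

lemma expectation_kernel_limit:
  assumes diff: "\<And>s. s \<in> {0..1} \<Longrightarrow> G differentiable (at s within {0..1})"
    and int: "set_integrable lborel {0..1} (deriv01 G)"
    and supp: "\<And>s. s \<notin> {0..1} \<Longrightarrow> G s = 0"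
    and tau: "\<And>s. s \<in> {0..1} \<Longrightarrow> ((\<lambda>t. F (t * s) / F t) \<longlongrightarrow> \<tau> s) (at_right 0)"
  shows "((\<lambda>t. expectation (\<lambda>x. G (Z x / t)) / F t) \<longlongrightarrow> G 1 - (LBINT s:{0..1}. deriv01 G s * \<tau> s)) (at_right 0)"
proof (rule tendsto_at_right_sequentially[of 0 1])
  fix S :: "nat \<Rightarrow> real" assume S: "\<And>n. 0 < S n" "S \<longlonglongrightarrow> 0"
  have S': "filterlim S (at_right 0) sequentially"
    using S by (auto simp: filterlim_at less_imp_neq[symmetric] intro!: always_eventually)
  define g where "g s = indicator {0..1} s *\<^sub>R deriv01 G s" for s
  have g: "integrable lborel g" using int unfolding set_integrable_def g_def .
  then have g_m[measurable]: "g \<in> borel_measurable borel" by simp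
  have lim: "(\<lambda>n. g s * (F (S n * s) / F (S n))) \<longlonglongrightarrow> g s * \<tau> s" for s
  proof (cases "s \<in> {0..1}")
    case True
    show ?thesis by (intro tendsto_mult_left filterlim_compose[OF tau[OF True] S'])
  qed (simp add: g_def)
  have "(\<lambda>n. LBINT s. g s * (F (S n * s) / F (S n))) \<longlonglongrightarrow> (LBINT s. g s * \<tau> s)"
  proof (rule integral_dominated_convergence)
    \<comment> \<open>Measurability of \<tau> is not assumed; on the unit interval it is inherited
      from the ratios of which \<tau> is the limit.\<close>
    show "(\<lambda>s. g s * \<tau> s) \<in> borel_measurable lborel"
      by (rule borel_measurable_LIMSEQ_real[OF lim]) simp
    show "integrable lborel (\<lambda>s. \<bar>g s\<bar>)" using g by simp
    show "AE s in lborel. (\<lambda>n. g s * (F (S n * s) / F (S n))) \<longlonglongrightarrow> g s * \<tau> s" using lim by simp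
    fix n
    show "AE s in lborel. norm (g s * (F (S n * s) / F (S n))) \<le> \<bar>g s\<bar>"
    proof (rule AE_I2)
      fix s
      show "norm (g s * (F (S n * s) / F (S n))) \<le> \<bar>g s\<bar>"
      proof (cases "s \<in> {0..1}")
        case True
        then have "F (S n * s) \<le> F (S n)" using S(1)[of n] by (intro F_mono) simp
        then have "\<bar>F (S n * s) / F (S n)\<bar> \<le> 1"
          using F_nonneg[of "S n * s"] F_pos[OF S(1)[of n]] by simp
        then show ?thesis by (simp only: real_norm_def abs_mult mult_left_le abs_ge_zero)
      qed (simp add: g_def)
    qed
  qed simp
  then have "(\<lambda>n. G 1 - (LBINT s. g s * (F (S n * s) / F (S n)))) \<longlonglongrightarrow> G 1 - (LBINT s. g s * \<tau> s)"
    by (intro tendsto_intros)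
  moreover have "expectation (\<lambda>x. G (Z x / S n)) / F (S n) = G 1 - (LBINT s. g s * (F (S n * s) / F (S n)))" for n
  proof -
    have "(LBINT s. g s * (F (S n * s) / F (S n))) = (LBINT s. g s * F (S n * s)) / F (S n)"
      by (simp flip: integral_divide_zero)
    also have "(LBINT s. g s * F (S n * s)) = (LBINT s:{0..1}. deriv01 G s * F (S n * s))"
      by (simp add: set_lebesgue_integral_def g_def mult.assoc)
    finally show ?thesis
      using F_pos[OF S(1)[of n]] expectation_kernel[OF diff int supp S(1), of n]
      by (simp add: diff_divide_distrib)
  qed
  ultimately show "(\<lambda>n. expectation (\<lambda>x. G (Z x / S n)) / F (S n)) \<longlonglongrightarrow> G 1 - (LBINT s:{0..1}. deriv01 G s * \<tau> s)"
    by (simp add: set_lebesgue_integral_def g_def mult.assoc)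
qed simp

text \<open>The factor \<open>Q (Z x / t)\<close> vanishes outside the ball of radius
  \<open>t\<close>, where \<open>V\<close> is close to \<open>v\<close> once \<open>t\<close> is
  small. The same localisation provides integrability for small \<open>t\<close>, although
  \<open>V\<close> itself need not be integrable.\<close>

lemma expectation_localized_limit:
  fixes V :: "'w \<Rightarrow> real"
  assumes V[measurable]: "random_variable borel V" and Q[measurable]: "Q \<in> borel_measurable borel"
    and cont: "\<And>e. 0 < e \<Longrightarrow> \<exists>d>0. \<forall>x\<in>space M. Z x < d \<longrightarrow> \<bar>V x - v\<bar> < e"
    and Q_bound: "\<And>s. 0 \<le> Q s" "\<And>s. Q s \<le> B"
    and supp: "\<And>s. s \<notin> {0..1} \<Longrightarrow> Q s = 0"
    and lim: "((\<lambda>t. expectation (\<lambda>x. Q (Z x / t)) / F t) \<longlongrightarrow> q) (at_right 0)"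
  shows "((\<lambda>t. expectation (\<lambda>x. V x * Q (Z x / t)) / F t) \<longlongrightarrow> v * q) (at_right 0)"
proof -
  have Q_int: "integrable M (\<lambda>x. Q (Z x / t))" for t
    by (rule integrable_const_bound[where B=B]) (use Q_bound in auto)
  have loc: "\<bar>V x - v\<bar> * Q (Z x / t) \<le> e * Q (Z x / t)"
    if "\<forall>x\<in>space M. Z x < d \<longrightarrow> \<bar>V x - v\<bar> < e" "t < d" "0 < t" "x \<in> space M" for x t d e
  proof (cases "Z x / t \<in> {0..1}")
    case True
    then have "Z x < d" using that by (auto simp: field_simps)
    then show ?thesis using that Q_bound by (intro mult_right_mono) (auto simp: less_imp_le)
  qed (simp add: supp)
  have int': "integrable M (\<lambda>x. (V x - v) * Q (Z x / t))"
    if "\<forall>x\<in>space M. Z x < d \<longrightarrow> \<bar>V x - v\<bar> < e" "t < d" "0 < t" for t d e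
    by (rule Bochner_Integration.integrable_bound[OF integrable_mult_right[OF Q_int[of t], of e]])
      (auto simp: abs_mult Q_bound intro!: AE_I2 order_trans[OF loc[OF that]] mult_right_mono[OF abs_ge_self])
  have int: "integrable M (\<lambda>x. V x * Q (Z x / t))"
    if "integrable M (\<lambda>x. (V x - v) * Q (Z x / t))" for t
    using Bochner_Integration.integrable_add[OF that integrable_mult_right[OF Q_int[of t], of v]]
    by (simp add: algebra_simps)
  obtain d where d: "0 < d" "\<forall>x\<in>space M. Z x < d \<longrightarrow> \<bar>V x - v\<bar> < 1"
    using cont[of 1] by auto
  have "\<forall>\<^sub>F t in at_right 0. 0 < t \<and> t < d"
    using d by (auto simp: eventually_at_right)
  then have ev: "\<forall>\<^sub>F t in at_right 0. integrable M (\<lambda>x. V x * Q (Z x / t))"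
    by eventually_elim (intro int int'[OF d(2)]; simp)
  have "((\<lambda>t. expectation (\<lambda>x. (V x - v) * Q (Z x / t)) / F t) \<longlongrightarrow> 0) (at_right 0)"
  proof (rule tendstoI)
    fix e :: real assume e: "0 < e"
    \<comment> \<open>The normalised mass of \<open>Q\<close> eventually stays below
      \<open>\<bar>q\<bar> + 1\<close>, so this oscillation of \<open>V\<close> costs less than
      \<open>e\<close>.\<close>
    define e' where "e' = e / (\<bar>q\<bar> + 1)"
    have e': "0 < e'" using e by (simp add: e'_def)
    obtain d where d: "0 < d" "\<forall>x\<in>space M. Z x < d \<longrightarrow> \<bar>V x - v\<bar> < e'"
      using cont[OF e'] by auto
    have "\<forall>\<^sub>F t in at_right 0. 0 < t \<and> t < d"
      using d by (auto simp: eventually_at_right)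
    moreover have "\<forall>\<^sub>F t in at_right 0. expectation (\<lambda>x. Q (Z x / t)) / F t < \<bar>q\<bar> + 1"
      by (rule order_tendstoD[OF lim]) simp
    ultimately show "\<forall>\<^sub>F t in at_right 0. dist (expectation (\<lambda>x. (V x - v) * Q (Z x / t)) / F t) 0 < e"
    proof eventually_elim
      case (elim t)
      have "\<bar>expectation (\<lambda>x. (V x - v) * Q (Z x / t))\<bar> \<le> expectation (\<lambda>x. \<bar>(V x - v) * Q (Z x / t)\<bar>)"
        by (rule integral_abs_bound)
      also have "\<dots> \<le> expectation (\<lambda>x. e' * Q (Z x / t))"
        using elim integrable_abs[OF int'[OF d(2)]] loc[OF d(2)] Q_int Q_bound
        by (intro integral_mono) (auto simp: abs_mult)
      finally have "\<bar>expectation (\<lambda>x. (V x - v) * Q (Z x / t)) / F t\<bar> \<le> e' * (expectation (\<lambda>x. Q (Z x / t)) / F t)"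
        using F_pos[of t] elim by (simp add: divide_right_mono)
      also have "\<dots> < e' * (\<bar>q\<bar> + 1)" using elim e' by (intro mult_strict_left_mono)
      also have "\<dots> = e" by (simp add: e'_def)
      finally show ?case by simp
    qed
  qed
  from tendsto_add[OF this tendsto_mult_left[OF lim, of v]]
  have "((\<lambda>t. expectation (\<lambda>x. (V x - v) * Q (Z x / t)) / F t + v * (expectation (\<lambda>x. Q (Z x / t)) / F t)) \<longlongrightarrow> v * q) (at_right 0)"
    by simp
  then show "((\<lambda>t. expectation (\<lambda>x. V x * Q (Z x / t)) / F t) \<longlongrightarrow> v * q) (at_right 0)"
  proof (rule Lim_transform_eventually)
    show "\<forall>\<^sub>F t in at_right 0. expectation (\<lambda>x. (V x - v) * Q (Z x / t)) / F t + v * (expectation (\<lambda>x. Q (Z x / t)) / F t) =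
        expectation (\<lambda>x. V x * Q (Z x / t)) / F t"
      using ev
    proof eventually_elim
      case (elim t)
      then have "expectation (\<lambda>x. (V x - v) * Q (Z x / t)) = expectation (\<lambda>x. V x * Q (Z x / t)) - v * expectation (\<lambda>x. Q (Z x / t))"
        using Q_int by (simp add: left_diff_distrib)
      then show ?case by (simp add: diff_divide_distrib)
    qed
  qed
qed

end

context small_ball
begin

text \<open>Testing the conditional expectation against small balls shows \<open>\<phi> 0 = 0\<close>, so that
  \<open>\<phi> z = z (\<phi>' + o(1))\<close>; the factor \<open>z\<close> turns the kernel \<open>K s\<close> into \<open>s * K s\<close>.\<close>

lemma cond_exp_radial_limit:
  fixes R :: "'w \<Rightarrow> real"
  assumes ce: "cond_exp_given M Z R \<phi>"
    and cont: "\<And>e. 0 < e \<Longrightarrow> \<exists>d>0. \<forall>x\<in>space M. Z x < d \<longrightarrow> \<bar>R x\<bar> < e"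
    and deriv: "(\<phi> has_real_derivative \<phi>') (at 0 within {0..})"
    and K[measurable]: "K \<in> borel_measurable borel"
    and K_bound: "\<And>s. 0 \<le> K s" "\<And>s. K s \<le> B"
    and supp: "\<And>s. s \<notin> {0..1} \<Longrightarrow> K s = 0"
    and lim: "((\<lambda>t. expectation (\<lambda>x. Z x / t * K (Z x / t)) / F t) \<longlongrightarrow> q) (at_right 0)"
  shows "((\<lambda>t. expectation (\<lambda>x. K (Z x / t) * R x) / (t * F t)) \<longlongrightarrow> q * \<phi>') (at_right 0)"
proof -
  have R: "integrable M R" and phi[measurable]: "\<phi> \<in> borel_measurable borel"
    using ce by (auto simp: cond_exp_given_def)
  then have R_m[measurable]: "random_variable borel R" by simp
  have ce_eq: "expectation (\<lambda>x. k (Z x) * R x) = expectation (\<lambda>x. k (Z x) * \<phi> (Z x))"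
    if k[measurable]: "k \<in> borel_measurable borel" and b: "\<And>s. \<bar>k s\<bar> \<le> b" for k :: "real \<Rightarrow> real" and b
  proof (rule cond_exp_given_integral[OF prob_space_axioms ce Z_measurable k])
    show "integrable M (\<lambda>x. k (Z x) * R x)"
    proof (rule Bochner_Integration.integrable_bound[OF integrable_mult_right[OF R, of b]])
      show "AE x in M. norm (k (Z x) * R x) \<le> norm (b * R x)"
        using b by (auto simp: abs_mult intro!: AE_I2 mult_right_mono order_trans[OF b abs_ge_self])
    qed simp
  qed
  have phi0: "\<phi> 0 = 0"
  proof -
    \<comment> \<open>With this test function the normalised mass is exactly 1. Localising the two
      sides of the conditional expectation identity gives the limits \<open>\<phi> 0\<close> and 0
      for one and the same function of \<open>t\<close>.\<close>
    let ?Q = "indicator {0..1} :: real \<Rightarrow> real"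
    have "\<forall>\<^sub>F t in at_right 0. 1 = expectation (\<lambda>x. ?Q (Z x / t)) / F t"
      unfolding eventually_at_right_field
    proof (intro exI[of _ 1] conjI allI impI)
      fix t :: real assume t: "0 < t"
      have "expectation (\<lambda>x. ?Q (Z x / t)) = expectation (\<lambda>x. indicator {..t} (Z x))"
        using t Z_nonneg by (intro Bochner_Integration.integral_cong) (auto simp: indicator_def)
      then show "1 = expectation (\<lambda>x. ?Q (Z x / t)) / F t"
        using F_pos[OF t] by (simp add: F_eq_expectation)
    qed simp
    then have Q: "((\<lambda>t. expectation (\<lambda>x. ?Q (Z x / t)) / F t) \<longlongrightarrow> 1) (at_right 0)"
      by (rule Lim_transform_eventually[OF tendsto_const])
    have c\<phi>: "\<exists>d>0. \<forall>x\<in>space M. Z x < d \<longrightarrow> \<bar>\<phi> (Z x) - \<phi> 0\<bar> < e" if "0 < e" for e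
    proof -
      have "continuous (at 0 within {0..}) \<phi>" using deriv by (rule DERIV_continuous)
      then have "\<forall>e>0. \<exists>d>0. \<forall>z\<in>{0..}. z < d \<longrightarrow> \<bar>\<phi> z - \<phi> 0\<bar> < e"
        by (auto simp: continuous_within_eps_delta dist_real_def)
      then obtain d where "d > 0" "\<forall>z\<in>{0..}. z < d \<longrightarrow> \<bar>\<phi> z - \<phi> 0\<bar> < e"
        using \<open>0 < e\<close> by blast
      then show ?thesis using Z_nonneg by (intro exI[of _ d]) auto
    qed
    have "((\<lambda>t. expectation (\<lambda>x. \<phi> (Z x) * ?Q (Z x / t)) / F t) \<longlongrightarrow> \<phi> 0 * 1) (at_right 0)"
      by (rule expectation_localized_limit[where B=1, OF _ _ c\<phi> _ _ _ Q]) (auto simp: indicator_def)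
    moreover have "((\<lambda>t. expectation (\<lambda>x. R x * ?Q (Z x / t)) / F t) \<longlongrightarrow> 0 * 1) (at_right 0)"
      by (rule expectation_localized_limit[where B=1, OF _ _ _ _ _ _ Q]) (use cont in \<open>auto simp: indicator_def\<close>)
    moreover have "expectation (\<lambda>x. R x * ?Q (Z x / t)) = expectation (\<lambda>x. \<phi> (Z x) * ?Q (Z x / t))" for t
      using ce_eq[of "\<lambda>z. ?Q (z / t)" 1] by (simp add: mult.commute indicator_def)
    ultimately have "\<phi> 0 * 1 = 0 * 1"
      by (intro tendsto_unique[OF trivial_limit_at_right_real]) auto
    then show ?thesis by simp
  qed
  \<comment> \<open>The difference quotient of \<phi>, extended by its limit to be continuous at 0.
    It satisfies \<open>z * \<psi> z = \<phi> z\<close> for every \<open>z\<close>, including 0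
    because of \<open>phi0\<close>.\<close>
  define \<psi> where "\<psi> z = (if z = 0 then \<phi>' else \<phi> z / z)" for z
  have [measurable]: "\<psi> \<in> borel_measurable borel" unfolding \<psi>_def[abs_def] by measurable
  have c\<psi>: "\<exists>d>0. \<forall>x\<in>space M. Z x < d \<longrightarrow> \<bar>\<psi> (Z x) - \<phi>'\<bar> < e" if "0 < e" for e
  proof -
    have "((\<lambda>z. \<phi> z / z) \<longlongrightarrow> \<phi>') (at 0 within {0..})"
      using deriv by (simp add: has_field_derivative_iff phi0)
    then have "\<forall>e>0. \<exists>d>0. \<forall>z\<in>{0..}. z \<noteq> 0 \<and> z < d \<longrightarrow> \<bar>\<phi> z / z - \<phi>'\<bar> < e"
      by (auto simp: tendsto_iff eventually_at dist_real_def)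
    then obtain d where "d > 0" "\<forall>z\<in>{0..}. z \<noteq> 0 \<and> z < d \<longrightarrow> \<bar>\<phi> z / z - \<phi>'\<bar> < e"
      using \<open>0 < e\<close> by blast
    then show ?thesis using Z_nonneg that by (intro exI[of _ d]) (auto simp: \<psi>_def)
  qed
  have "((\<lambda>t. expectation (\<lambda>x. \<psi> (Z x) * (Z x / t * K (Z x / t))) / F t) \<longlongrightarrow> \<phi>' * q) (at_right 0)"
  proof (rule expectation_localized_limit[where B=B and Q="\<lambda>s. s * K s", OF _ _ c\<psi> _ _ _ lim])
    show "0 \<le> s * K s" for s using K_bound(1)[of s] supp[of s] by (cases "s \<in> {0..1}") auto
    show "s * K s \<le> B" for s
    proof (cases "s \<in> {0..1}")
      case True
      then have "s * K s \<le> 1 * K s" using K_bound(1) by (intro mult_right_mono) auto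
      then show ?thesis using K_bound(2)[of s] by simp
    next
      case False
      then show ?thesis using K_bound(1)[of s] K_bound(2)[of s] supp[OF False] by simp
    qed
  qed (use supp in auto)
  moreover have "\<forall>\<^sub>F t in at_right 0. expectation (\<lambda>x. \<psi> (Z x) * (Z x / t * K (Z x / t))) / F t =
      expectation (\<lambda>x. K (Z x / t) * R x) / (t * F t)"
    unfolding eventually_at_right_field
  proof (intro exI[of _ 1] conjI allI impI)
    fix t :: real assume t: "0 < t"
    have "expectation (\<lambda>x. K (Z x / t) * R x) = expectation (\<lambda>x. K (Z x / t) * \<phi> (Z x))"
      by (rule ce_eq[of "\<lambda>z. K (z / t)" B]) (use K_bound in auto)
    also have "\<dots> = expectation (\<lambda>x. t * (\<psi> (Z x) * (Z x / t * K (Z x / t))))"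
      using t by (intro Bochner_Integration.integral_cong) (auto simp: \<psi>_def phi0)
    finally show "expectation (\<lambda>x. \<psi> (Z x) * (Z x / t * K (Z x / t))) / F t =
        expectation (\<lambda>x. K (Z x / t) * R x) / (t * F t)"
      using t by simp
  qed simp
  ultimately show ?thesis
    unfolding mult.commute[of q \<phi>'] by (rule Lim_transform_eventually)
qed

end

subsection \<open>Recursively weighted kernel sums\<close>

text \<open>The arithmetic core: \<open>f i = F (h i)\<close>, \<open>U i = K (\<parallel>chi - X\<^sub>i\<parallel> / h i)\<close>, \<open>T i = Y\<^sub>i - r chi\<close>, and
  \<open>b n\<close> is a truncation level for \<open>T\<close>.\<close>

locale recursive_kernel_array = prob_space M for M :: "'w measure" +
  fixes U T :: "nat \<Rightarrow> 'w \<Rightarrow> real" and f h b :: "nat \<Rightarrow> real" and \<beta> :: "real \<Rightarrow> real"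
    and l B C \<alpha> c u1 u2 m0 s :: real
  assumes indep: "indep_vars (\<lambda>_. borel \<Otimes>\<^sub>M borel) (\<lambda>i x. (U i x, T i x)) {1..}"
    and U_nonneg: "\<And>i x. i \<ge> 1 \<Longrightarrow> x \<in> space M \<Longrightarrow> 0 \<le> U i x"
    and U_le: "\<And>i x. i \<ge> 1 \<Longrightarrow> x \<in> space M \<Longrightarrow> U i x \<le> B"
    and T_sq: "\<And>i. i \<ge> 1 \<Longrightarrow> integrable M (\<lambda>x. (T i x)\<^sup>2)"
    and f_pos: "\<And>i. i \<ge> 1 \<Longrightarrow> 0 < f i" and f_le: "\<And>i. i \<ge> 1 \<Longrightarrow> f i \<le> 1"
    and h_pos: "\<And>i. i \<ge> 1 \<Longrightarrow> 0 < h i" and h_lim: "h \<longlonglongrightarrow> 0"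
    and l: "0 \<le> l" "l \<le> 1"
    and nf_lim: "filterlim (\<lambda>n. real n * f n) at_top sequentially"
    and A_lim: "(\<lambda>n. 1 / real n * (\<Sum>i=1..n. h i / h n * (f i / f n) powr (1 - l))) \<longlonglongrightarrow> \<alpha>"
    and B_lim: "\<And>q. q \<le> 2 \<Longrightarrow> (\<lambda>n. 1 / real n * (\<Sum>i=1..n. (f i / f n) powr q)) \<longlonglongrightarrow> \<beta> q"
    and c_lim: "(\<lambda>n. h n * sqrt (real n * f n)) \<longlonglongrightarrow> c"
    and U_lim: "(\<lambda>i. expectation (U i) / f i) \<longlonglongrightarrow> u1" and u1_pos: "0 < u1"
    and U2_lim: "(\<lambda>i. expectation (\<lambda>x. (U i x)\<^sup>2) / f i) \<longlonglongrightarrow> u2"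
    and UT_lim: "(\<lambda>i. expectation (\<lambda>x. U i x * T i x) / (h i * f i)) \<longlonglongrightarrow> m0"
    and UT2_lim: "(\<lambda>i. expectation (\<lambda>x. (U i x * T i x)\<^sup>2) / f i) \<longlonglongrightarrow> s"
    and b_nonneg: "\<And>n. 0 \<le> b n"
    and b_lim: "(\<lambda>n. b n / sqrt (real n * f n)) \<longlonglongrightarrow> 0"
    and tail: "\<And>i n. i \<ge> 1 \<Longrightarrow> n \<ge> 1 \<Longrightarrow>
        expectation (\<lambda>x. (T i x)\<^sup>2 * indicator {b n<..} \<bar>T i x\<bar>) \<le> C / (real n)\<^sup>2"
begin

lemma UT_measurable: "i \<ge> 1 \<Longrightarrow> random_variable borel (U i)" "i \<ge> 1 \<Longrightarrow> random_variable borel (T i)"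
proof -
  assume "i \<ge> 1"
  then have m: "(\<lambda>x. (U i x, T i x)) \<in> M \<rightarrow>\<^sub>M borel \<Otimes>\<^sub>M borel"
    using indep by (auto simp: indep_vars_def)
  from measurable_fst'[OF m] measurable_snd'[OF m]
  show "random_variable borel (U i)" "random_variable borel (T i)" by simp_all
qed

lemma B_nonneg: "0 \<le> B"
proof -
  obtain x where "x \<in> space M" using not_empty by auto
  then show ?thesis using U_nonneg[of 1 x] U_le[of 1 x] by simp
qed

lemma U_sq_integrable: "i \<ge> 1 \<Longrightarrow> integrable M (\<lambda>x. (U i x)\<^sup>2)"
  using UT_measurable(1)[of i] U_nonneg[of i] U_le[of i] B_nonneg
  by (intro integrable_const_bound[where B="B\<^sup>2"]) (auto intro!: AE_I2 power_mono)

lemma UT_sq_integrable: "i \<ge> 1 \<Longrightarrow> integrable M (\<lambda>x. (U i x * T i x)\<^sup>2)"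
proof -
  assume i: "i \<ge> 1"
  note [measurable] = UT_measurable[OF i]
  show ?thesis
  proof (rule Bochner_Integration.integrable_bound)
    show "integrable M (\<lambda>x. B\<^sup>2 * (T i x)\<^sup>2)" using T_sq[OF i] by simp
    show "AE x in M. norm ((U i x * T i x)\<^sup>2) \<le> norm (B\<^sup>2 * (T i x)\<^sup>2)"
      using U_nonneg[OF i] U_le[OF i]
      by (intro AE_I2) (auto simp: power_mult_distrib abs_mult intro!: mult_right_mono power_mono)
  qed simp
qed

section \<open>Power sums of small-ball probabilities and the normalising factors\<close>

lemma sum_powr_eq:
  assumes "n \<ge> 1"
  shows "(\<Sum>i=1..n. f i powr q) = real n * f n powr q * (1 / real n * (\<Sum>i=1..n. (f i / f n) powr q))"
proof -
  have "f n powr q * (f i / f n) powr q = f i powr q" if "i \<in> {1..n}" for i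
    using that f_pos[of i] f_pos[OF assms] by (simp add: powr_divide)
  then have "(\<Sum>i=1..n. f i powr q) = f n powr q * (\<Sum>i=1..n. (f i / f n) powr q)"
    by (simp add: sum_distrib_left)
  then show ?thesis using assms by simp
qed

text \<open>Reduces a limit of power sums to the last term: in effect the sum is
  \<open>n * f n powr q\<close> times \<beta> at \<open>q\<close>, and only the remaining power of
  \<open>f n\<close> has to be computed.\<close>

lemma scaled_sum_powr_limit:
  assumes "q \<le> 2" and g: "(\<lambda>n. a n * (real n * f n powr q)) \<longlonglongrightarrow> g"
  shows "(\<lambda>n. a n * (\<Sum>i=1..n. f i powr q)) \<longlonglongrightarrow> g * \<beta> q"
proof (rule Lim_transform_eventually[OF tendsto_mult[OF g B_lim[OF assms(1)]]])
  show "\<forall>\<^sub>F n in sequentially. a n * (real n * f n powr q) * (1 / real n * (\<Sum>i=1..n. (f i / f n) powr q)) =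
      a n * (\<Sum>i=1..n. f i powr q)"
    using eventually_ge_at_top[of 1] by eventually_elim (simp only: sum_powr_eq mult.assoc)
qed

text \<open>Reciprocal of the variance order of the unnormalised numerator: each summand has second
  moment of order \<open>f i powr (- 2 * l) * f i\<close>.\<close>

definition "v n = 1 / (real n * f n powr (1 - 2 * l))"

lemma v_nonneg: "0 \<le> v n"
  by (simp add: v_def)

lemma v_powr:
  assumes "n \<ge> 1"
  shows "v n * (real n * f n powr q) = f n powr (q - (1 - 2 * l))"
  using assms f_pos[OF assms] by (simp add: v_def powr_diff)

lemma inverse_nf_lim: "(\<lambda>n. 1 / (real n * f n)) \<longlonglongrightarrow> 0"
  using tendsto_inverse_0_at_top[OF nf_lim] by (simp add: inverse_eq_divide)

lemma v_le: "n \<ge> 1 \<Longrightarrow> v n \<le> 1 / (real n * f n)"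
proof -
  assume n: "n \<ge> 1"
  have "f n powr 1 \<le> f n powr (1 - 2 * l)"
    using f_pos[OF n] f_le[OF n] l by (intro powr_mono') auto
  then show ?thesis
    using f_pos[OF n] n by (auto simp: v_def intro!: divide_left_mono mult_left_mono mult_pos_pos)
qed

lemma v_lim: "v \<longlonglongrightarrow> 0"
  by (rule tendsto_sandwich[OF _ _ tendsto_const inverse_nf_lim])
    (auto simp: v_nonneg eventually_at_top_linorder intro!: exI[of _ 1] v_le)

lemma sqrt_v_lim: "(\<lambda>n. sqrt (v n)) \<longlonglongrightarrow> 0"
  using tendsto_real_sqrt[OF v_lim] by simp

text \<open>The quotient of the scalings of numerator and denominator; this is where the rate of the
  theorem appears.\<close>

lemma sqrt_v_eq: "n \<ge> 1 \<Longrightarrow> sqrt (v n) * (real n * f n powr (1 - l)) = sqrt (real n * f n)"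
proof -
  assume n: "n \<ge> 1"
  note f = f_pos[OF n]
  have "sqrt (v n) * (real n * f n powr (1 - l)) = sqrt (v n * (real n * f n powr (1 - l))\<^sup>2)"
    by (simp add: real_sqrt_mult)
  also have "v n * (real n * f n powr (1 - l))\<^sup>2 = (v n * (real n * f n powr (1 - l))) * (real n * f n powr (1 - l))"
    by (simp add: power2_eq_square)
  also have "\<dots> = real n * (f n powr l * f n powr (1 - l))"
    by (subst v_powr[OF n]) simp
  also have "f n powr l * f n powr (1 - l) = f n" using f by (simp flip: powr_add)
  finally show ?thesis .
qed

lemma sum_v_lim: "(\<lambda>n. v n * (\<Sum>i=1..n. f i powr (1 - 2 * l))) \<longlonglongrightarrow> \<beta> (1 - 2 * l)"
proof -
  have "(\<lambda>n. v n * (real n * f n powr (1 - 2 * l))) \<longlonglongrightarrow> 1"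
    by (rule Lim_transform_eventually[OF tendsto_const])
      (use f_pos in \<open>auto simp: v_powr less_imp_neq[symmetric] eventually_at_top_linorder intro!: exI[of _ 1]\<close>)
  from scaled_sum_powr_limit[OF _ this] l show ?thesis by simp
qed

section \<open>Moments of the normalised numerator and Lindeberg's condition\<close>

definition "V n i x = sqrt (v n) * f i powr (- l) * (U i x * T i x)"

lemma powr_minus_l:
  assumes "i \<ge> 1"
  shows "f i powr (- l) * f i = f i powr (1 - l)"
    and "(f i powr (- l))\<^sup>2 * f i = f i powr (1 - 2 * l)"
    and "(f i powr (- l))\<^sup>2 = f i powr (- 2 * l)"
proof -
  note f = f_pos[OF assms]
  then have 1: "f i powr (- l) * f i = f i powr (- l) * f i powr 1" by simp
  show "f i powr (- l) * f i = f i powr (1 - l)"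
    unfolding 1 powr_add[symmetric] by simp
  show 2: "(f i powr (- l))\<^sup>2 = f i powr (- 2 * l)"
    unfolding power2_eq_square powr_add[symmetric] by simp
  have 3: "f i powr (- 2 * l) * f i = f i powr (- 2 * l) * f i powr 1" using f by simp
  show "(f i powr (- l))\<^sup>2 * f i = f i powr (1 - 2 * l)"
    unfolding 2 3 powr_add[symmetric] by simp
qed

lemma V_sq_integrable: "i \<ge> 1 \<Longrightarrow> integrable M (\<lambda>x. (V n i x)\<^sup>2)"
  using UT_sq_integrable[of i] by (simp add: V_def power_mult_distrib[of _ "U i _ * T i _"])

text \<open>Arranged as a weight times a convergent sequence, the form expected by
  \<open>weighted_sum_tendsto\<close>; likewise for \<open>V_sq_mean\<close>.\<close>

lemma V_mean:
  assumes "i \<ge> 1"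
  shows "expectation (V n i) =
      sqrt (v n) * (h i * f i powr (1 - l) * (expectation (\<lambda>x. U i x * T i x) / (h i * f i)))"
proof -
  have "expectation (V n i) = sqrt (v n) * (f i powr (- l) * expectation (\<lambda>x. U i x * T i x))"
    by (simp add: V_def[abs_def])
  also have "f i powr (- l) = f i powr (1 - l) / f i"
    using f_pos[OF assms] by (simp flip: powr_minus_l(1)[OF assms])
  finally show ?thesis using h_pos[OF assms] by simp
qed

lemma V_sq_mean:
  assumes "i \<ge> 1"
  shows "expectation (\<lambda>x. (V n i x)\<^sup>2) = v n * (f i powr (1 - 2 * l) * (expectation (\<lambda>x. (U i x * T i x)\<^sup>2) / f i))"
proof -
  have "expectation (\<lambda>x. (V n i x)\<^sup>2) = v n * ((f i powr (- l))\<^sup>2 * expectation (\<lambda>x. (U i x * T i x)\<^sup>2))"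
    by (simp add: V_def power_mult_distrib[of _ "U i _ * T i _"] power_mult_distrib[of "sqrt _"] v_nonneg)
  also have "(f i powr (- l))\<^sup>2 = f i powr (1 - 2 * l) / f i"
    using f_pos[OF assms] by (simp flip: powr_minus_l(2)[OF assms])
  finally show ?thesis by simp
qed

lemma V_mean_lim: "(\<lambda>n. \<Sum>i=1..n. expectation (V n i)) \<longlonglongrightarrow> c * \<alpha> * m0"
proof -
  \<comment> \<open>Multiplying \<open>c_lim\<close> by \<open>A_lim\<close> cancels
    \<open>h n\<close> and leaves the total weight of the bias.\<close>
  have "(\<lambda>n. sqrt (v n) * (\<Sum>i=1..n. h i * f i powr (1 - l))) \<longlonglongrightarrow> c * \<alpha>"
  proof (rule Lim_transform_eventually[OF tendsto_mult[OF c_lim A_lim]])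
    show "\<forall>\<^sub>F n in sequentially. h n * sqrt (real n * f n) * (1 / real n * (\<Sum>i=1..n. h i / h n * (f i / f n) powr (1 - l))) =
        sqrt (v n) * (\<Sum>i=1..n. h i * f i powr (1 - l))"
      using eventually_ge_at_top[of 1]
    proof eventually_elim
      case (elim n)
      have "h n * f n powr (1 - l) * (h i / h n * (f i / f n) powr (1 - l)) = h i * f i powr (1 - l)"
        if "i \<in> {1..n}" for i
        using that f_pos[of i] f_pos[OF elim] h_pos[OF elim] by (simp add: powr_divide)
      then have "(\<Sum>i=1..n. h i * f i powr (1 - l)) =
          h n * f n powr (1 - l) * (\<Sum>i=1..n. h i / h n * (f i / f n) powr (1 - l))"
        by (simp add: sum_distrib_left)
      then show ?case using elim by (simp add: sqrt_v_eq[symmetric])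
    qed
  qed
  from weighted_sum_tendsto[OF sqrt_v_lim _ _ this UT_lim]
  have "(\<lambda>n. sqrt (v n) * (\<Sum>i=1..n. h i * f i powr (1 - l) * (expectation (\<lambda>x. U i x * T i x) / (h i * f i)))) \<longlonglongrightarrow> c * \<alpha> * m0"
    using h_pos by (simp add: v_nonneg less_imp_le)
  then show ?thesis by (simp add: V_mean sum_distrib_left)
qed

lemma V_sq_mean_lim: "(\<lambda>n. \<Sum>i=1..n. expectation (\<lambda>x. (V n i x)\<^sup>2)) \<longlonglongrightarrow> \<beta> (1 - 2 * l) * s"
  using weighted_sum_tendsto[OF v_lim v_nonneg _ sum_v_lim UT2_lim]
  by (simp add: V_sq_mean sum_distrib_left)

text \<open>A squared mean carries the same weight as a second moment, times
  \<open>f i * (h i)\<^sup>2\<close> and a convergent factor. As \<open>f i\<close> is at most 1 and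
  \<open>h i\<close> tends to 0, a null sequence is averaged.\<close>

lemma V_mean_sq_lim: "(\<lambda>n. \<Sum>i=1..n. (expectation (V n i))\<^sup>2) \<longlonglongrightarrow> 0"
proof -
  let ?m = "\<lambda>i. expectation (\<lambda>x. U i x * T i x) / (h i * f i)"
  have z: "(\<lambda>i. f i * (h i * ?m i)\<^sup>2) \<longlonglongrightarrow> 0"
  proof (rule Lim_null_comparison)
    show "\<forall>\<^sub>F i in sequentially. norm (f i * (h i * ?m i)\<^sup>2) \<le> (h i * ?m i)\<^sup>2"
      using f_pos f_le by (auto simp: eventually_at_top_linorder abs_mult less_imp_le intro!: exI[of _ 1] mult_left_le_one_le)
    show "(\<lambda>i. (h i * ?m i)\<^sup>2) \<longlonglongrightarrow> 0"
      by (rule tendsto_eq_rhs[OF tendsto_power[OF tendsto_mult[OF h_lim UT_lim]]]) simp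
  qed
  have "(expectation (V n i))\<^sup>2 = v n * (f i powr (1 - 2 * l) * (f i * (h i * ?m i)\<^sup>2))" if "i \<in> {1..n}" for n i
  proof -
    have i: "i \<ge> 1" using that by simp
    have "(f i powr (1 - l))\<^sup>2 = f i powr (1 - 2 * l) * f i"
      by (simp add: powr_minus_l(1)[OF i, symmetric] powr_minus_l(2)[OF i, symmetric] power2_eq_square)
    then show ?thesis
      by (simp only: V_mean[OF i] power_mult_distrib v_nonneg real_sqrt_pow2) simp
  qed
  then show ?thesis
    using weighted_sum_tendsto[OF v_lim v_nonneg _ sum_v_lim z] by (simp add: sum_distrib_left)
qed

text \<open>Squaring the second moments doubles the exponent to \<open>2 - 4 * l\<close>, which
  reaches the bound 2 in \<open>B_lim\<close> at \<open>l = 0\<close>. The prefactor left over is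
  \<open>1 / n\<close>.\<close>

lemma V_sq_mean_sq_lim: "(\<lambda>n. \<Sum>i=1..n. (expectation (\<lambda>x. (V n i x)\<^sup>2))\<^sup>2) \<longlonglongrightarrow> 0"
proof -
  have "(\<lambda>n. (v n)\<^sup>2 * (real n * f n powr (2 - 4 * l))) \<longlonglongrightarrow> 0"
  proof (rule Lim_transform_eventually[OF lim_1_over_n])
    show "\<forall>\<^sub>F n in sequentially. 1 / real n = (v n)\<^sup>2 * (real n * f n powr (2 - 4 * l))"
      using eventually_ge_at_top[of 1]
    proof eventually_elim
      case (elim n)
      have "(v n)\<^sup>2 * (real n * f n powr (2 - 4 * l)) = v n * f n powr (1 - 2 * l)"
        unfolding power2_eq_square mult.assoc v_powr[OF elim] by simp
      also have "\<dots> = 1 / real n" using f_pos[OF elim] by (simp add: v_def)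
      finally show ?case ..
    qed
  qed
  from scaled_sum_powr_limit[OF _ this] l
  have L: "(\<lambda>n. (v n)\<^sup>2 * (\<Sum>i=1..n. f i powr (2 - 4 * l))) \<longlonglongrightarrow> 0" by simp
  have v2: "(\<lambda>n. (v n)\<^sup>2) \<longlonglongrightarrow> 0" using tendsto_power[OF v_lim, of 2] by simp
  have "(expectation (\<lambda>x. (V n i x)\<^sup>2))\<^sup>2 =
      (v n)\<^sup>2 * (f i powr (2 - 4 * l) * (expectation (\<lambda>x. (U i x * T i x)\<^sup>2) / f i)\<^sup>2)" if "i \<in> {1..n}" for n i
  proof -
    have i: "i \<ge> 1" using that by simp
    have "(f i powr (1 - 2 * l))\<^sup>2 = f i powr (2 - 4 * l)"
      by (simp add: power2_eq_square flip: powr_add)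
    then show ?thesis by (simp only: V_sq_mean[OF i] power_mult_distrib)
  qed
  then show ?thesis
    using weighted_sum_tendsto[OF v2 _ _ L tendsto_power[OF UT2_lim, of 2]] by (simp add: sum_distrib_left)
qed

text \<open>Truncating at \<open>\<bar>T\<bar> \<le> b n\<close>: below the threshold the third moment costs one factor \<open>b n\<close>
  over the second, above it the second moment is of order \<open>1 / n\<^sup>2\<close>.\<close>

lemma V_min_le:
  assumes i: "i \<ge> 1" and n: "n \<ge> 1"
  shows "expectation (\<lambda>x. min ((V n i x)\<^sup>2) (\<bar>V n i x\<bar> ^ 3)) \<le>
    B\<^sup>2 * C / (real n)\<^sup>2 * (v n * f i powr (- 2 * l)) +
    B * b n * (sqrt (v n) * f i powr (- l)) * expectation (\<lambda>x. (V n i x)\<^sup>2)"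
proof -
  note [measurable] = UT_measurable[OF i]
  let ?w = "sqrt (v n) * f i powr (- l)"
  have w0: "0 \<le> ?w" by (simp add: v_nonneg)
  have w2: "?w\<^sup>2 = v n * f i powr (- 2 * l)"
    using powr_minus_l(3)[OF i] by (simp add: power_mult_distrib v_nonneg)
  let ?t = "\<lambda>x. (T i x)\<^sup>2 * indicator {b n<..} \<bar>T i x\<bar>"
  have t_int: "integrable M ?t"
    by (rule Bochner_Integration.integrable_bound[OF T_sq[OF i]]) (auto simp: indicator_def)
  note V_int = V_sq_integrable[OF i, of n]
  have Vm[measurable]: "random_variable borel (V n i)" unfolding V_def by measurable
  have "expectation (\<lambda>x. min ((V n i x)\<^sup>2) (\<bar>V n i x\<bar> ^ 3)) \<le>
      expectation (\<lambda>x. ?w\<^sup>2 * B\<^sup>2 * ?t x + B * b n * ?w * (V n i x)\<^sup>2)"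
  proof (rule integral_mono)
    show "integrable M (\<lambda>x. min ((V n i x)\<^sup>2) (\<bar>V n i x\<bar> ^ 3))"
      by (rule Bochner_Integration.integrable_bound[OF V_int]) auto
    show "integrable M (\<lambda>x. ?w\<^sup>2 * B\<^sup>2 * ?t x + B * b n * ?w * (V n i x)\<^sup>2)"
      using t_int V_int by (intro Bochner_Integration.integrable_add integrable_mult_right)
    fix x assume x: "x \<in> space M"
    have U: "\<bar>U i x\<bar> \<le> B" using U_nonneg[OF i x] U_le[OF i x] by simp
    show "min ((V n i x)\<^sup>2) (\<bar>V n i x\<bar> ^ 3) \<le> ?w\<^sup>2 * B\<^sup>2 * ?t x + B * b n * ?w * (V n i x)\<^sup>2"
    proof (cases "b n < \<bar>T i x\<bar>")
      case True
      have "(V n i x)\<^sup>2 = ?w\<^sup>2 * (\<bar>U i x\<bar>\<^sup>2 * (T i x)\<^sup>2)"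
        by (simp add: V_def power_mult_distrib)
      also have "\<dots> \<le> ?w\<^sup>2 * (B\<^sup>2 * (T i x)\<^sup>2)"
        using U by (intro mult_left_mono mult_right_mono power_mono) auto
      finally have "(V n i x)\<^sup>2 \<le> ?w\<^sup>2 * B\<^sup>2 * ?t x" using True by (simp add: mult.assoc)
      moreover have "0 \<le> B * b n * ?w * (V n i x)\<^sup>2"
        using w0 B_nonneg b_nonneg by simp
      ultimately show ?thesis by linarith
    next
      case False
      have "\<bar>V n i x\<bar> = ?w * (\<bar>U i x\<bar> * \<bar>T i x\<bar>)"
        using w0 by (simp add: V_def abs_mult v_nonneg)
      also have "\<dots> \<le> ?w * (B * b n)"
        using False U w0 B_nonneg by (intro mult_left_mono mult_mono) auto
      finally have "\<bar>V n i x\<bar> * \<bar>V n i x\<bar>\<^sup>2 \<le> B * b n * ?w * \<bar>V n i x\<bar>\<^sup>2"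
        by (intro mult_right_mono) (auto simp: mult_ac)
      then have "\<bar>V n i x\<bar> ^ 3 \<le> B * b n * ?w * (V n i x)\<^sup>2"
        by (simp add: power3_eq_cube power2_eq_square)
      then show ?thesis using False by simp
    qed
  qed
  also have "\<dots> = ?w\<^sup>2 * B\<^sup>2 * expectation ?t + B * b n * ?w * expectation (\<lambda>x. (V n i x)\<^sup>2)"
    using t_int V_int by simp
  also have "\<dots> \<le> ?w\<^sup>2 * B\<^sup>2 * (C / (real n)\<^sup>2) + B * b n * ?w * expectation (\<lambda>x. (V n i x)\<^sup>2)"
    by (intro add_right_mono mult_left_mono tail i n) simp
  finally show ?thesis unfolding w2 by (simp add: mult_ac)
qed

text \<open>The tail part has weights \<open>f i powr (- 2 * l)\<close>, without the factor
  \<open>f i\<close> of a localised moment, and its total is of order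
  \<open>1 / (n * (n * f n))\<close>. The truncated part totals at most a multiple of
  \<open>b n / sqrt (n * f n)\<close>.\<close>

lemma V_lindeberg: "(\<lambda>n. \<Sum>i=1..n. expectation (\<lambda>x. min ((V n i x)\<^sup>2) (\<bar>V n i x\<bar> ^ 3))) \<longlonglongrightarrow> 0"
proof -
  let ?a = "\<lambda>i. expectation (\<lambda>x. (U i x * T i x)\<^sup>2) / f i"
  obtain A where "\<And>i. norm (?a i) \<le> A"
    using convergent_imp_Bseq[OF convergentI[OF UT2_lim]] unfolding Bseq_def by blast
  then have A: "?a i \<le> A" for i unfolding real_norm_def by (rule order_trans[OF abs_ge_self])
  define p where "p n = B\<^sup>2 * C / (real n)\<^sup>2 * v n" for n
  define q where "q n = A * B * b n * sqrt (v n) * v n" for n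
  have bound: "(\<Sum>i=1..n. expectation (\<lambda>x. min ((V n i x)\<^sup>2) (\<bar>V n i x\<bar> ^ 3))) \<le>
      p n * (\<Sum>i=1..n. f i powr (- 2 * l)) + q n * (\<Sum>i=1..n. f i powr (1 - 3 * l))" if n: "n \<ge> 1" for n
    unfolding sum_distrib_left sum.distrib[symmetric]
  proof (rule sum_mono)
    fix i assume "i \<in> {1..n}"
    then have i: "i \<ge> 1" by simp
    have "expectation (\<lambda>x. (V n i x)\<^sup>2) \<le> v n * (f i powr (1 - 2 * l) * A)"
      unfolding V_sq_mean[OF i] using A[of i] by (intro mult_left_mono v_nonneg) auto
    then have "B * b n * (sqrt (v n) * f i powr (- l)) * expectation (\<lambda>x. (V n i x)\<^sup>2) \<le>
        B * b n * (sqrt (v n) * f i powr (- l)) * (v n * (f i powr (1 - 2 * l) * A))"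
      using B_nonneg b_nonneg v_nonneg by (intro mult_left_mono) auto
    also have "\<dots> = q n * (f i powr (- l) * f i powr (1 - 2 * l))"
      by (simp add: q_def mult_ac)
    also have "f i powr (- l) * f i powr (1 - 2 * l) = f i powr (1 - 3 * l)"
      by (simp flip: powr_add)
    finally show "expectation (\<lambda>x. min ((V n i x)\<^sup>2) (\<bar>V n i x\<bar> ^ 3)) \<le>
        p n * f i powr (- 2 * l) + q n * f i powr (1 - 3 * l)"
      using V_min_le[OF i n] by (simp add: p_def mult.assoc)
  qed
  have p: "(\<lambda>n. p n * (\<Sum>i=1..n. f i powr (- 2 * l))) \<longlonglongrightarrow> 0 * \<beta> (- 2 * l)"
  proof (rule scaled_sum_powr_limit)
    have "(\<lambda>n. B\<^sup>2 * C * (1 / real n) * (1 / (real n * f n))) \<longlonglongrightarrow> B\<^sup>2 * C * 0 * 0"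
      by (intro tendsto_intros lim_1_over_n inverse_nf_lim)
    then have "(\<lambda>n. B\<^sup>2 * C * (1 / real n) * (1 / (real n * f n))) \<longlonglongrightarrow> 0" by simp
    then show "(\<lambda>n. p n * (real n * f n powr (- 2 * l))) \<longlonglongrightarrow> 0"
    proof (rule Lim_transform_eventually)
      show "\<forall>\<^sub>F n in sequentially. B\<^sup>2 * C * (1 / real n) * (1 / (real n * f n)) = p n * (real n * f n powr (- 2 * l))"
        using eventually_ge_at_top[of 1]
      proof eventually_elim
        case (elim n)
        have "f n powr (- 2 * l - (1 - 2 * l)) = 1 / f n"
          using f_pos[OF elim] by (simp add: powr_minus inverse_eq_divide)
        then show ?case
          unfolding p_def mult.assoc v_powr[OF elim] by (simp add: power2_eq_square)
      qed
    qed
  qed (use l in simp)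
  have q: "(\<lambda>n. q n * (\<Sum>i=1..n. f i powr (1 - 3 * l))) \<longlonglongrightarrow> 0 * \<beta> (1 - 3 * l)"
  proof (rule scaled_sum_powr_limit)
    have "(\<lambda>n. A * B * (b n / sqrt (real n * f n))) \<longlonglongrightarrow> 0"
      using tendsto_mult_left[OF b_lim, of "A * B"] by simp
    then show "(\<lambda>n. q n * (real n * f n powr (1 - 3 * l))) \<longlonglongrightarrow> 0"
    proof (rule Lim_transform_eventually)
      show "\<forall>\<^sub>F n in sequentially. A * B * (b n / sqrt (real n * f n)) = q n * (real n * f n powr (1 - 3 * l))"
        using eventually_ge_at_top[of 1]
      proof eventually_elim
        case (elim n)
        note f = f_pos[OF elim]
        have "sqrt (v n) * f n powr (- l) = sqrt (v n * (f n powr (- l))\<^sup>2)"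
          by (simp add: real_sqrt_mult)
        also have "v n * (f n powr (- l))\<^sup>2 = 1 / (real n * f n)"
          unfolding v_def powr_minus_l(2)[OF elim, symmetric] using f by simp
        finally have "sqrt (v n) * f n powr (- l) = 1 / sqrt (real n * f n)"
          by (simp add: real_sqrt_divide)
        moreover have "1 - 3 * l - (1 - 2 * l) = - l" by simp
        ultimately show ?case
          unfolding q_def mult.assoc v_powr[OF elim] by simp
      qed
    qed
  qed (use l in simp)
  show ?thesis
  proof (rule tendsto_sandwich[OF _ _ tendsto_const])
    show "(\<lambda>n. p n * (\<Sum>i=1..n. f i powr (- 2 * l)) + q n * (\<Sum>i=1..n. f i powr (1 - 3 * l))) \<longlonglongrightarrow> 0"
      using tendsto_add[OF p q] by simp
  qed (use bound in \<open>auto simp: eventually_at_top_linorder intro!: sum_nonneg exI[of _ 1]\<close>)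
qed

section \<open>The denominator and the limit law of the quotient\<close>

lemma indep_compose:
  assumes "\<And>i. (\<lambda>y. G i (fst y) (snd y)) \<in> borel_measurable (borel \<Otimes>\<^sub>M borel)"
  shows "indep_vars (\<lambda>_. borel) (\<lambda>i x. G i (U i x) (T i x)) {1..n}"
  using indep_vars_compose2[OF indep_vars_subset[OF indep, of "{1..n}"], of "\<lambda>i y. G i (fst y) (snd y)" "\<lambda>_. borel"] assms
  by auto

lemma V_indep: "indep_vars (\<lambda>_. borel) (V n) {1..n}"
  unfolding V_def[abs_def] by (rule indep_compose) measurable

definition "S n x = (\<Sum>i=1..n. V n i x)"
text \<open>The mean of \<open>f i powr (- l) * U i x\<close> is of order
  \<open>f i powr (1 - l)\<close>, so this scaling gives the denominator a positive finite
  limit.\<close>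

definition "D n x = (\<Sum>i=1..n. 1 / (real n * f n powr (1 - l)) * f i powr (- l) * U i x)"

lemma \<beta>_pos: "0 < \<beta> (1 - l)"
proof (rule power_mean_limit_pos[OF _ B_lim B_lim])
  show "\<forall>\<^sub>F n in sequentially. \<forall>i\<in>{1..n}. 0 < f i / f n"
    using f_pos by (auto simp: eventually_at_top_linorder intro!: exI[of _ 1])
qed (use l in simp_all)

text \<open>The error is bounded by the squared bias of \<open>D n\<close> plus the sum of the
  second moments of its summands. The bias vanishes by weighted averaging; the sum is of order
  \<open>1 / (n * f n)\<close>.\<close>

lemma D_lim:
  shows "integrable M (\<lambda>x. (D n x - \<beta> (1 - l) * u1)\<^sup>2)"
    and "(\<lambda>n. expectation (\<lambda>x. (D n x - \<beta> (1 - l) * u1)\<^sup>2)) \<longlonglongrightarrow> 0"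
proof -
  let ?d = "\<beta> (1 - l) * u1"
  define g where "g n = 1 / (real n * f n powr (1 - l))" for n
  define R where "R n i x = g n * f i powr (- l) * U i x" for n i x
  have D_eq: "D n x = (\<Sum>i=1..n. R n i x)" for n x by (simp add: D_def R_def g_def)
  have g0: "0 \<le> g n" for n by (simp add: g_def)
  have R_indep: "indep_vars (\<lambda>_. borel) (R n) {1..n}" for n
    unfolding R_def[abs_def] by (rule indep_compose) measurable
  have R_sq: "integrable M (\<lambda>x. (R n i x)\<^sup>2)" if "i \<in> {1..n}" for n i
    using U_sq_integrable[of i] that by (simp add: R_def power_mult_distrib[of _ "U i _"])
  note D2 = expectation_square_indep_sum_le[OF finite_atLeastAtMost R_indep R_sq, folded D_eq]
  have D_m[measurable]: "random_variable borel (D n)" for n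
    unfolding D_def[abs_def] by (intro borel_measurable_sum borel_measurable_times borel_measurable_const UT_measurable) auto
  have D_int: "integrable M (D n)" for n
    by (rule square_integrable_imp_integrable[OF D_m D2(1)]) auto
  show D2_int: "integrable M (\<lambda>x. (D n x - ?d)\<^sup>2)" for n
    using D2(1)[of n] D_int[of n] by (simp add: power2_diff)
  have R_int: "integrable M (R n i)" if "i \<in> {1..n}" for n i
    using UT_measurable(1)[of i] that by (intro square_integrable_imp_integrable[OF _ R_sq[OF that]]) (simp add: R_def)
  have g_lim: "g \<longlonglongrightarrow> 0"
  proof (rule tendsto_sandwich[OF _ _ tendsto_const inverse_nf_lim])
    have "g n \<le> 1 / (real n * f n)" if n: "n \<ge> 1" for n
    proof -
      have "f n powr 1 \<le> f n powr (1 - l)"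
        using f_pos[OF n] f_le[OF n] l by (intro powr_mono') auto
      then show ?thesis
        using f_pos[OF n] n by (auto simp: g_def intro!: divide_left_mono mult_left_mono mult_pos_pos)
    qed
    then show "\<forall>\<^sub>F n in sequentially. g n \<le> 1 / (real n * f n)"
      by (auto simp: eventually_at_top_linorder intro!: exI[of _ 1])
  qed (simp add: g0)
  have "(\<lambda>n. g n * (real n * f n powr (1 - l))) \<longlonglongrightarrow> 1"
    by (rule Lim_transform_eventually[OF tendsto_const])
      (use f_pos in \<open>auto simp: g_def less_imp_neq[symmetric] eventually_at_top_linorder intro!: exI[of _ 1]\<close>)
  from scaled_sum_powr_limit[OF _ this] l
  have "(\<lambda>n. g n * (\<Sum>i=1..n. f i powr (1 - l))) \<longlonglongrightarrow> \<beta> (1 - l)" by simp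
  from weighted_sum_tendsto[OF g_lim g0 _ this U_lim]
  have "(\<lambda>n. g n * (\<Sum>i=1..n. f i powr (1 - l) * (expectation (U i) / f i))) \<longlonglongrightarrow> ?d" by simp
  moreover have "expectation (R n i) = g n * (f i powr (1 - l) * (expectation (U i) / f i))" if "i \<in> {1..n}" for n i
    using that f_pos[of i] by (simp add: R_def[abs_def] powr_minus_l(1)[symmetric])
  ultimately have R_mean: "(\<lambda>n. \<Sum>i=1..n. expectation (R n i)) \<longlonglongrightarrow> ?d"
    by (simp add: sum_distrib_left)
  \<comment> \<open>Comparing with \<open>v n\<close> makes the weights those of
    \<open>sum_v_lim\<close>, with an additional factor \<open>1 / (n * f n)\<close>.\<close>
  have g2: "(g n)\<^sup>2 = 1 / (real n * f n) * v n" if n: "n \<ge> 1" for n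
  proof -
    have "(g n)\<^sup>2 = v n / (sqrt (v n) * (real n * f n powr (1 - l)))\<^sup>2"
      using f_pos[OF n] n by (simp add: g_def power_mult_distrib power_divide v_nonneg) (simp add: v_def)
    also have "(sqrt (v n) * (real n * f n powr (1 - l)))\<^sup>2 = real n * f n"
      unfolding sqrt_v_eq[OF n] using f_pos[OF n] by simp
    finally show ?thesis by simp
  qed
  have "(\<lambda>n. 1 / (real n * f n) * (v n * (\<Sum>i=1..n. f i powr (1 - 2 * l)))) \<longlonglongrightarrow> 0 * \<beta> (1 - 2 * l)"
    by (intro tendsto_mult inverse_nf_lim sum_v_lim)
  then have L: "(\<lambda>n. (g n)\<^sup>2 * (\<Sum>i=1..n. f i powr (1 - 2 * l))) \<longlonglongrightarrow> 0"
    by (rule Lim_transform_eventually[OF _ eventually_mono[OF eventually_ge_at_top[of 1]], THEN tendsto_eq_rhs])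
      (auto simp: g2)
  have "(\<lambda>n. (g n)\<^sup>2 * (\<Sum>i=1..n. f i powr (1 - 2 * l) * (expectation (\<lambda>x. (U i x)\<^sup>2) / f i))) \<longlonglongrightarrow> 0 * u2"
    using tendsto_power[OF g_lim, of 2] by (intro weighted_sum_tendsto L U2_lim) auto
  moreover have "expectation (\<lambda>x. (R n i x)\<^sup>2) = (g n)\<^sup>2 * (f i powr (1 - 2 * l) * (expectation (\<lambda>x. (U i x)\<^sup>2) / f i))"
    if "i \<in> {1..n}" for n i
  proof -
    have i: "i \<ge> 1" using that by simp
    have "(f i powr (- l))\<^sup>2 = f i powr (1 - 2 * l) / f i"
      using f_pos[OF i] by (simp flip: powr_minus_l(2)[OF i])
    then show ?thesis by (simp add: R_def power_mult_distrib)
  qed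
  ultimately have R_sq_lim: "(\<lambda>n. \<Sum>i=1..n. expectation (\<lambda>x. (R n i x)\<^sup>2)) \<longlonglongrightarrow> 0"
    by (simp add: sum_distrib_left)
  have D_le: "expectation (\<lambda>x. (D n x - ?d)\<^sup>2) \<le>
      (\<Sum>i=1..n. expectation (\<lambda>x. (R n i x)\<^sup>2)) + ((\<Sum>i=1..n. expectation (R n i)) - ?d)\<^sup>2" for n
  proof -
    have "expectation (D n) = (\<Sum>i=1..n. expectation (R n i))"
      unfolding D_eq[abs_def] by (intro Bochner_Integration.integral_sum R_int)
    moreover have "expectation (\<lambda>x. (D n x - ?d)\<^sup>2) = expectation (\<lambda>x. (D n x)\<^sup>2) + ?d\<^sup>2 - 2 * expectation (D n) * ?d"
      using D2(1)[of n] D_int[of n] by (simp add: power2_diff prob_space)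
    ultimately show ?thesis using D2(2)[of n] by (simp add: power2_diff)
  qed
  show "(\<lambda>n. expectation (\<lambda>x. (D n x - ?d)\<^sup>2)) \<longlonglongrightarrow> 0"
  proof (rule tendsto_sandwich[OF _ _ tendsto_const])
    show "(\<lambda>n. (\<Sum>i=1..n. expectation (\<lambda>x. (R n i x)\<^sup>2)) + ((\<Sum>i=1..n. expectation (R n i)) - ?d)\<^sup>2) \<longlonglongrightarrow> 0"
      using R_mean R_sq_lim by (auto intro!: tendsto_eq_intros)
  qed (intro always_eventually allI D_le | simp)+
qed

text \<open>\<open>W\<close> is prescribed only where the denominator is nonzero, so the convention
  chosen for a vanishing denominator does not influence the limit.\<close>

theorem weak_conv_self_normalized_sum:
  assumes W_measurable: "\<And>n. random_variable borel (W n)"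
    and W: "\<And>n x. x \<in> space M \<Longrightarrow> (\<Sum>i=1..n. f i powr (- l) * U i x) \<noteq> 0 \<Longrightarrow>
      W n x = sqrt (real n * f n) *
        ((\<Sum>i=1..n. f i powr (- l) * (U i x * T i x)) / (\<Sum>i=1..n. f i powr (- l) * U i x))"
  shows "weak_conv_m (\<lambda>n. distr M borel (W n))
    (normal_law (c * \<alpha> * m0 / (\<beta> (1 - l) * u1)) (\<beta> (1 - 2 * l) * s / (\<beta> (1 - l) * u1)\<^sup>2))"
proof (rule weak_conv_ratio[where S=S and D=D and d="\<beta> (1 - l) * u1"])
  let ?d = "\<beta> (1 - l) * u1"
  show d: "0 < ?d" using \<beta>_pos u1_pos by simp
  show "random_variable borel (S n)" "random_variable borel (D n)" "random_variable borel (W n)" for n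
    unfolding S_def[abs_def] D_def[abs_def] V_def[abs_def]
    by (intro borel_measurable_sum borel_measurable_times borel_measurable_const UT_measurable W_measurable; simp)+
  note S2 = expectation_square_indep_sum_le[OF finite_atLeastAtMost V_indep V_sq_integrable, folded S_def]
  show "integrable M (\<lambda>x. (S n x)\<^sup>2)" for n by (rule S2) simp
  show "integrable M (\<lambda>x. (D n x - ?d)\<^sup>2)" for n by (rule D_lim)
  show "(\<lambda>n. expectation (\<lambda>x. (D n x - ?d)\<^sup>2)) \<longlonglongrightarrow> 0" by (rule D_lim)
  have "convergent (\<lambda>n. (\<Sum>i=1..n. expectation (\<lambda>x. (V n i x)\<^sup>2)) + (\<Sum>i=1..n. expectation (V n i))\<^sup>2)"
    using tendsto_add[OF V_sq_mean_lim tendsto_power[OF V_mean_lim, of 2]] by (rule convergentI)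
  then obtain A where "\<And>n. norm ((\<Sum>i=1..n. expectation (\<lambda>x. (V n i x)\<^sup>2)) + (\<Sum>i=1..n. expectation (V n i))\<^sup>2) \<le> A"
    by (rule convergent_imp_Bseq[THEN BseqE]) blast
  then have "norm (expectation (\<lambda>x. (S n x)\<^sup>2)) \<le> A" for n
    using S2(2)[of n] by (simp add: abs_le_iff) (meson order_trans)
  then show "Bseq (\<lambda>n. expectation (\<lambda>x. (S n x)\<^sup>2))" by (rule BseqI')
  \<comment> \<open>Nonnegativity of the limiting variance is inherited from the second moments
    converging to it; no sign of the individual factors is used.\<close>
  have var: "0 \<le> \<beta> (1 - 2 * l) * s"
    by (rule tendsto_lowerbound[OF V_sq_mean_lim]) (auto intro!: always_eventually sum_nonneg)
  then have var': "0 \<le> \<beta> (1 - 2 * l) * s / ?d\<^sup>2" by simp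
  show "real_distribution (normal_law (c * \<alpha> * m0 / ?d) (\<beta> (1 - 2 * l) * s / ?d\<^sup>2))"
    by (rule real_distribution_normal_law[OF var'])
  show "(\<lambda>n. char (distr M borel (S n)) (t / ?d)) \<longlonglongrightarrow>
      char (normal_law (c * \<alpha> * m0 / ?d) (\<beta> (1 - 2 * l) * s / ?d\<^sup>2)) t" for t
  proof -
    have "(\<lambda>n. char (distr M borel (S n)) (t / ?d)) \<longlonglongrightarrow>
        exp (\<i> * complex_of_real (c * \<alpha> * m0 * (t / ?d)) - complex_of_real (\<beta> (1 - 2 * l) * s * (t / ?d)\<^sup>2 / 2))"
      unfolding S_def[abs_def]
      by (rule char_triangular_array)
        (rule V_indep V_sq_integrable V_mean_lim V_sq_mean_lim V_mean_sq_lim V_sq_mean_sq_lim V_lindeberg | simp)+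
    then show ?thesis unfolding char_normal_law[OF var'] by (simp add: power_divide)
  qed
  \<comment> \<open>A nonzero \<open>D n x\<close> excludes \<open>n = 0\<close>, where the sum is
    empty, and so makes \<open>sqrt_v_eq\<close> applicable.\<close>
  fix n x assume x: "x \<in> space M" and "D n x \<noteq> 0"
  let ?g = "real n * f n powr (1 - l)"
  have D: "D n x = (\<Sum>i=1..n. f i powr (- l) * U i x) / ?g"
    by (simp add: D_def sum_divide_distrib)
  with \<open>D n x \<noteq> 0\<close> have n: "n \<ge> 1" and nz: "?g \<noteq> 0" and U: "(\<Sum>i=1..n. f i powr (- l) * U i x) \<noteq> 0"
    by (auto simp: Suc_le_eq)
  have "S n x = sqrt (v n) * (\<Sum>i=1..n. f i powr (- l) * (U i x * T i x))"
    by (simp add: S_def V_def sum_distrib_left mult.assoc)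
  then show "W n x = S n x / D n x"
    unfolding W[OF x U] D sqrt_v_eq[OF n, symmetric] using nz by simp
qed

end

subsection \<open>The central limit theorem for the recursive estimator\<close>

theorem theorem3:
  fixes M :: "'w measure"
    and p :: "'e::banach \<Rightarrow> real"
    and X :: "'w \<Rightarrow> 'e" and Y :: "'w \<Rightarrow> real"
    and Xs :: "nat \<Rightarrow> 'w \<Rightarrow> 'e" and Ys eps :: "nat \<Rightarrow> 'w \<Rightarrow> real"
    and r \<sigma>2 :: "'e \<Rightarrow> real"
    and chi :: 'e and l :: real
    and F \<phi> K \<tau>0 \<beta> :: "real \<Rightarrow> real"
    and h :: "nat \<Rightarrow> real"
    and \<phi>' \<alpha> c :: real
  assumes prob: "prob_space M"
    and seminorm: "seminorm p" "p \<in> borel_measurable borel"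
    and X_meas: "X \<in> borel_measurable M" and Y_meas: "Y \<in> borel_measurable M"
    and Xs_meas: "\<And>i. i \<ge> 1 \<Longrightarrow> Xs i \<in> borel_measurable M"
    and Ys_meas: "\<And>i. i \<ge> 1 \<Longrightarrow> Ys i \<in> borel_measurable M"
    and indep: "prob_space.indep_vars M (\<lambda>_. borel \<Otimes>\<^sub>M borel) (\<lambda>i \<omega>. (Xs i \<omega>, Ys i \<omega>)) {1..}"
    and ident: "\<And>i. i \<ge> 1 \<Longrightarrow>
        distr M (borel \<Otimes>\<^sub>M borel) (\<lambda>\<omega>. (Xs i \<omega>, Ys i \<omega>)) =
        distr M (borel \<Otimes>\<^sub>M borel) (\<lambda>\<omega>. (X \<omega>, Y \<omega>))"
    and regression: "cond_exp_given M X Y r"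
    and model: "\<And>i \<omega>. i \<ge> 1 \<Longrightarrow> \<omega> \<in> space M \<Longrightarrow> Ys i \<omega> = r (Xs i \<omega>) + eps i \<omega>"
    and eps_mean: "\<And>i. i \<ge> 1 \<Longrightarrow> cond_exp_given M (Xs i) (eps i) (\<lambda>_. 0)"
    and eps_var: "\<And>i. i \<ge> 1 \<Longrightarrow> cond_exp_given M (Xs i) (\<lambda>\<omega>. (eps i \<omega>)\<^sup>2) \<sigma>2"
    and F_eq: "\<And>t. F t = measure M {\<omega> \<in> space M. p (chi - X \<omega>) \<le> t}"
    and h_pos: "\<And>n. n \<ge> 1 \<Longrightarrow> h n > 0"
    and l_range: "l \<in> {0..1}"
    and r_cont: "seminorm_continuous_near p chi r"
    and \<sigma>2_cont: "seminorm_continuous_near p chi \<sigma>2"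
    and F_zero: "F 0 = 0"
    and \<phi>_cond: "cond_exp_given M (\<lambda>\<omega>. p (X \<omega> - chi)) (\<lambda>\<omega>. r (X \<omega>) - r chi) \<phi>"
    and \<phi>_deriv: "(\<phi> has_real_derivative \<phi>') (at 0 within {0..})"
    and K_nonneg: "\<And>t. 0 \<le> K t"
    and K_bounded: "bounded (range K)"
    and K_support: "\<And>t. t \<notin> {0..1} \<Longrightarrow> K t = 0"
    and K_inf: "0 < (INF t\<in>{0..1}. K t)"
    and K_diff: "\<And>t. t \<in> {0..1} \<Longrightarrow> K differentiable (at t within {0..1})"
    and K_deriv_integrable: "set_integrable lborel {0..1} (deriv01 K)"
    and tau: "\<And>s. s \<in> {0..1} \<Longrightarrow> ((\<lambda>t. F (t * s) / F t) \<longlongrightarrow> \<tau>0 s) (at_right 0)"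
    and h_lim: "h \<longlonglongrightarrow> 0"
    and nF_lim: "filterlim (\<lambda>n. real n * F (h n)) at_top sequentially"
    and A_lim: "(\<lambda>n. 1 / real n * (\<Sum>i=1..n. h i / h n * (F (h i) / F (h n)) powr (1 - l))) \<longlonglongrightarrow> \<alpha>"
    and B_lim: "\<And>q. q \<le> 2 \<Longrightarrow>
        (\<lambda>n. 1 / real n * (\<Sum>i=1..n. (F (h i) / F (h n)) powr q)) \<longlonglongrightarrow> \<beta> q"
    and exp_moment: "\<exists>lam>0. \<exists>\<mu>>0. integrable M (\<lambda>\<omega>. exp (lam * \<bar>Y \<omega>\<bar> powr \<mu>))"
    and log_cond: "\<And>\<delta>. \<delta> > 0 \<Longrightarrow>
        (\<lambda>n. ln (real n) powr \<delta> / sqrt (real n * F (h n))) \<longlonglongrightarrow> 0"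
    and c_nonneg: "c \<ge> 0"
    and c_lim: "(\<lambda>n. h n * sqrt (real n * F (h n))) \<longlonglongrightarrow> c"
  shows "weak_conv_m
      (\<lambda>n. distr M borel (\<lambda>\<omega>. sqrt (real n * F (h n)) *
              (recursive_estimator p K F h l Xs Ys chi n \<omega> - r chi)))
      (normal_law (c * (\<alpha> / \<beta> (1 - l)) * (M0 K \<tau>0 / M1 K \<tau>0) * \<phi>')
                  (\<beta> (1 - 2 * l) / (\<beta> (1 - l))\<^sup>2 * (M2 K \<tau>0 / (M1 K \<tau>0)\<^sup>2) * \<sigma>2 chi))"
proof -
  interpret prob_space M by (rule prob)
  define a where "a = r chi"
  define q where "q y = p (y - chi)" for y
  have p_nonneg: "0 \<le> p y" for y using seminorm(1) by (simp add: seminorm_def)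
  have p_scale: "p (u *\<^sub>R y) = \<bar>u\<bar> * p y" for u y using seminorm(1) by (simp add: seminorm_def)
  \<comment> \<open>The estimator and \<open>F\<close> measure \<open>chi - X\<close>, whereas
    \<phi> and the continuity hypotheses measure \<open>X - chi\<close>.\<close>
  have p_sym: "p (chi - y) = q y" for y
    using p_scale[of "-1" "y - chi"] by (simp add: q_def)
  have q0: "q chi = 0" using p_scale[of 0 0] by (simp add: q_def)
  have q_m[measurable]: "q \<in> borel_measurable borel"
  proof -
    have "(\<lambda>y. y - chi) \<in> borel_measurable borel"
      by (intro borel_measurable_continuous_onI continuous_intros)
    from measurable_compose[OF this seminorm(2)] show ?thesis by (simp add: q_def[abs_def])
  qed
  define Z where "Z x = q (X x)" for x
  note X_meas[measurable] and Y_meas[measurable]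
  have r_m[measurable]: "r \<in> borel_measurable borel" and Y_int: "integrable M Y"
    using regression by (auto simp: cond_exp_given_def)
  have \<sigma>2_m[measurable]: "\<sigma>2 \<in> borel_measurable borel"
    using eps_var[of 1] by (auto simp: cond_exp_given_def)
  have F_eq': "F t = prob {x \<in> space M. Z x \<le> t}" for t
    unfolding F_eq p_sym Z_def ..
  \<comment> \<open>Since \<open>n * F (h n)\<close> tends to infinity, \<open>F\<close> is positive
    at arbitrarily small radii, and monotonicity does the rest.\<close>
  have F_pos: "0 < F t" if t: "0 < t" for t
  proof -
    have "\<forall>\<^sub>F n in sequentially. h n < t" by (rule order_tendstoD(2)[OF h_lim t])
    moreover have "\<forall>\<^sub>F n in sequentially. 0 < real n * F (h n)"
      using nF_lim by (simp add: filterlim_at_top_dense)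
    ultimately have "\<forall>\<^sub>F n in sequentially. h n < t \<and> 0 < real n * F (h n)"
      by eventually_elim simp
    then obtain n where n: "h n < t" "0 < real n * F (h n)"
      by (auto simp: eventually_sequentially)
    have "F (h n) \<le> F t"
      unfolding F_eq' using n(1) by (intro finite_measure_mono) (auto simp: Z_def)
    moreover have "0 < F (h n)" using n(2) by (simp add: zero_less_mult_iff)
    ultimately show ?thesis by simp
  qed
  interpret B: small_ball M Z F
  proof unfold_locales
    show "random_variable borel Z" unfolding Z_def[abs_def] by measurable
    show "0 \<le> Z x" for x by (simp add: Z_def q_def p_nonneg)
    show "F t = prob {x \<in> space M. Z x \<le> t}" for t by (rule F_eq')
    show "0 < F t" if "0 < t" for t using that by (rule F_pos)
  qed

  \<comment> \<open>Small-ball limits for the pair \<open>(X, Y)\<close>\<close>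
  have K_cont: "continuous_on {0..1} K" using K_diff by (rule differentiable01_continuous_on)
  have K_m[measurable]: "K \<in> borel_measurable borel"
    using K_cont K_support by (rule continuous_on_imp_measurable_supported)
  obtain b0 where b0: "\<And>t. K t \<le> b0"
    using K_bounded by (auto simp: bounded_iff abs_le_iff)
  have K2_le: "(K t)\<^sup>2 \<le> b0\<^sup>2" for t using K_nonneg b0 by (intro power_mono)
  have M1: "((\<lambda>t. expectation (\<lambda>x. K (Z x / t)) / F t) \<longlongrightarrow> M1 K \<tau>0) (at_right 0)"
    unfolding M1_def by (rule B.expectation_kernel_limit[OF K_diff K_deriv_integrable K_support tau])
  have M2: "((\<lambda>t. expectation (\<lambda>x. (K (Z x / t))\<^sup>2) / F t) \<longlongrightarrow> M2 K \<tau>0) (at_right 0)"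
    unfolding M2_def
  proof (rule B.expectation_kernel_limit[of "\<lambda>s. (K s)\<^sup>2", OF _ _ _ tau])
    show "set_integrable lborel {0..1} (deriv01 (\<lambda>s. (K s)\<^sup>2))"
      unfolding power2_eq_square by (rule deriv01_mult_integrable[OF K_diff K_deriv_integrable K_diff K_deriv_integrable])
  qed (auto intro!: differentiable_mult K_diff simp: K_support power2_eq_square)
  have M0: "((\<lambda>t. expectation (\<lambda>x. Z x / t * K (Z x / t)) / F t) \<longlongrightarrow> M0 K \<tau>0) (at_right 0)"
  proof -
    have "((\<lambda>t. expectation (\<lambda>x. Z x / t * K (Z x / t)) / F t) \<longlongrightarrow>
        1 * K 1 - (LBINT s:{0..1}. deriv01 (\<lambda>s. s * K s) s * \<tau>0 s)) (at_right 0)"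
    proof (rule B.expectation_kernel_limit[of "\<lambda>s. s * K s", OF _ _ _ tau])
      show "set_integrable lborel {0..1} (deriv01 (\<lambda>s. s * K s))"
        by (rule deriv01_mult_integrable[OF _ deriv01_id_integrable K_diff K_deriv_integrable]) auto
    qed (auto intro!: differentiable_mult K_diff simp: K_support)
    then show ?thesis by (simp add: M0_def)
  qed

  have cont_at: "\<exists>d>0. \<forall>y. q y < d \<longrightarrow> \<bar>g y - g chi\<bar> < e"
    if near: "seminorm_continuous_near p chi g" and e: "0 < e" for g e
  proof -
    obtain \<rho> where "0 < \<rho>"
      and \<rho>: "\<forall>x. p (x - chi) < \<rho> \<longrightarrow> (\<forall>e>0. \<exists>d>0. \<forall>y. p (y - x) < d \<longrightarrow> \<bar>g y - g x\<bar> < e)"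
      using near unfolding seminorm_continuous_near_def by auto
    have "p (chi - chi) < \<rho>" using q0 \<open>0 < \<rho>\<close> by (simp add: q_def)
    from \<rho>[rule_format, OF this e] show ?thesis by (simp add: q_def)
  qed
  have cont_Z: "\<exists>d>0. \<forall>x\<in>space M. Z x < d \<longrightarrow> \<bar>g (X x) - g chi\<bar> < e"
    if "seminorm_continuous_near p chi g" "0 < e" for g e
    using cont_at[OF that] by (auto simp: Z_def)
  have L_mean: "((\<lambda>t. expectation (\<lambda>x. K (Z x / t) * (r (X x) - a)) / (t * F t)) \<longlongrightarrow> M0 K \<tau>0 * \<phi>') (at_right 0)"
  proof (rule B.cond_exp_radial_limit[OF _ _ \<phi>_deriv K_m K_nonneg b0 K_support M0])
    show "cond_exp_given M Z (\<lambda>x. r (X x) - a) \<phi>"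
      using \<phi>_cond by (simp add: Z_def[abs_def] q_def a_def)
    show "\<exists>d>0. \<forall>x\<in>space M. Z x < d \<longrightarrow> \<bar>r (X x) - a\<bar> < e" if "0 < e" for e
      using cont_Z[OF r_cont that] by (simp add: a_def)
  qed
  \<comment> \<open>Continuity of \<open>r\<close> at \<open>chi\<close> makes this part of the
    second moment negligible against \<open>F t\<close>, so only the noise contributes to the
    variance.\<close>
  have L_bias: "((\<lambda>t. expectation (\<lambda>x. (r (X x) - a)\<^sup>2 * (K (Z x / t))\<^sup>2) / F t) \<longlongrightarrow> 0 * M2 K \<tau>0) (at_right 0)"
  proof (rule B.expectation_localized_limit[where Q="\<lambda>s. (K s)\<^sup>2", OF _ _ _ _ K2_le _ M2])
    show "\<exists>d>0. \<forall>x\<in>space M. Z x < d \<longrightarrow> \<bar>(r (X x) - a)\<^sup>2 - 0\<bar> < e" if e: "0 < e" for e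
    proof -
      have "\<bar>u\<^sup>2 - 0\<bar> < e" if "\<bar>u\<bar> < sqrt e" for u :: real
        using power_strict_mono[OF that, of 2] e by simp
      moreover obtain d where "d > 0" "\<forall>x\<in>space M. Z x < d \<longrightarrow> \<bar>r (X x) - a\<bar> < sqrt e"
        using cont_Z[OF r_cont, of "sqrt e"] e by (auto simp: a_def)
      ultimately show ?thesis by blast
    qed
  qed (auto simp: K_support)
  have L_var: "((\<lambda>t. expectation (\<lambda>x. \<sigma>2 (X x) * (K (Z x / t))\<^sup>2) / F t) \<longlongrightarrow> \<sigma>2 chi * M2 K \<tau>0) (at_right 0)"
    by (rule B.expectation_localized_limit[where Q="\<lambda>s. (K s)\<^sup>2", OF _ _ cont_Z[OF \<sigma>2_cont] _ K2_le _ M2])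
      (auto simp: K_support)

  \<comment> \<open>Transfer to the independent copies\<close>
  define f where "f i = F (h i)" for i
  define U where "U i x = K (q (Xs i x) / h i)" for i x
  define T where "T i x = Ys i x - a" for i x
  have h_right: "filterlim h (at_right 0) sequentially"
    using h_lim h_pos by (auto simp: filterlim_at less_imp_neq[symmetric] eventually_at_top_linorder intro!: exI[of _ 1])
  note [measurable] = Xs_meas Ys_meas
  have pair_m: "(\<lambda>x. (Xs i x, Ys i x)) \<in> M \<rightarrow>\<^sub>M borel \<Otimes>\<^sub>M borel" if "i \<ge> 1" for i
    using that by measurable
  \<comment> \<open>The hypotheses on the errors concern the copies, those on \<phi> and
    \<open>F\<close> the pair \<open>(X, Y)\<close>; equality in law moves moments between
    them.\<close>
  have transfer: "expectation (\<lambda>x. G (Xs i x, Ys i x)) = expectation (\<lambda>x. G (X x, Y x))"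
    "integrable M (\<lambda>x. G (Xs i x, Ys i x)) \<longleftrightarrow> integrable M (\<lambda>x. G (X x, Y x))"
    if i: "i \<ge> 1" and G: "G \<in> borel_measurable (borel \<Otimes>\<^sub>M borel)" for i and G :: "'e \<times> real \<Rightarrow> real"
    using integral_distr[OF pair_m[OF i] G] integrable_distr_eq[OF pair_m[OF i] G]
      integral_distr[OF _ G, of "\<lambda>x. (X x, Y x)" M] integrable_distr_eq[OF _ G, of "\<lambda>x. (X x, Y x)" M]
    unfolding ident[OF i] by auto
  have transfer_X: "expectation (\<lambda>x. G (Xs i x)) = expectation (\<lambda>x. G (X x))"
    if "i \<ge> 1" and [measurable]: "G \<in> borel_measurable borel" for i and G :: "'e \<Rightarrow> real"
    using transfer(1)[of i "\<lambda>z. G (fst z)"] that by simp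
  obtain lam \<mu> where lam: "lam > 0" "\<mu> > 0" "integrable M (\<lambda>x. exp (lam * \<bar>Y x\<bar> powr \<mu>))"
    using exp_moment by auto
  obtain C where C: "\<And>b. b \<ge> 0 \<Longrightarrow>
      expectation (\<lambda>x. (Y x - a)\<^sup>2 * indicator {b<..} \<bar>Y x\<bar>) \<le> C * exp (- (lam / 2) * b powr \<mu>)"
    using exp_moment_tail(2)[OF Y_meas lam, of a] by blast
  have Y2: "integrable M (\<lambda>x. (Y x - a)\<^sup>2)" by (rule exp_moment_tail(1)[OF Y_meas lam])
  \<comment> \<open>Solves \<open>exp (- (lam / 2) * b' n powr \<mu>) = 1 / (real n)\<^sup>2\<close>
    for \<open>n \<ge> 1\<close>. The tail bound cuts at \<open>\<bar>Y\<bar>\<close> but the array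
    at \<open>\<bar>Y - a\<bar>\<close>; adding \<open>\<bar>a\<bar>\<close> to the level reconciles
    them.\<close>
  define b' where "b' n = (4 / lam * ln (real n)) powr (1 / \<mu>)" for n :: nat
  define b where "b n = b' n + \<bar>a\<bar>" for n
  have b'_nonneg: "0 \<le> b' n" for n by (simp add: b'_def)

  have eps_int: "integrable M (eps i)" "integrable M (\<lambda>x. (eps i x)\<^sup>2)" if "i \<ge> 1" for i
    using eps_mean[OF that] eps_var[OF that] by (auto simp: cond_exp_given_def)
  have bounded_mult: "integrable M (\<lambda>x. G (Xs i x) * V x)"
    if i: "i \<ge> 1" and [measurable]: "G \<in> borel_measurable borel" and b: "\<And>y. \<bar>G y\<bar> \<le> d" and V: "integrable M V"
    for i d and G :: "'e \<Rightarrow> real" and V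
  proof (rule Bochner_Integration.integrable_bound[OF integrable_mult_right[OF V, of d]])
    show "AE x in M. norm (G (Xs i x) * V x) \<le> norm (d * V x)"
      by (auto simp: abs_mult intro!: AE_I2 mult_right_mono order_trans[OF b abs_ge_self])
    show "(\<lambda>x. G (Xs i x) * V x) \<in> borel_measurable M"
      using i V by measurable
  qed
  have eps_zero: "expectation (\<lambda>x. G (Xs i x) * eps i x) = 0"
    if i: "i \<ge> 1" and G: "G \<in> borel_measurable borel" and b: "\<And>y. \<bar>G y\<bar> \<le> d" for i d and G :: "'e \<Rightarrow> real"
    using cond_exp_given_integral[OF prob eps_mean[OF i] Xs_meas[OF i] G bounded_mult[OF i G b eps_int(1)[OF i]]] by simp

  \<comment> \<open>The conditionally centred error integrates to 0 against functions of the
    covariate, so the mean of the numerator is pure regression bias.\<close>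
  have UT_eq: "expectation (\<lambda>x. U i x * T i x) = expectation (\<lambda>x. K (Z x / h i) * (r (X x) - a))" if i: "i \<ge> 1" for i
  proof -
    let ?G = "\<lambda>y. K (q y / h i)"
    have G: "?G \<in> borel_measurable borel" "\<bar>?G y\<bar> \<le> b0" for y using K_nonneg b0 by simp_all
    have ri: "integrable M (\<lambda>x. r (Xs i x) - a)"
    proof (subst Bochner_Integration.integrable_cong[OF refl, where g="\<lambda>x. Ys i x - eps i x - a"])
      show "integrable M (\<lambda>x. Ys i x - eps i x - a)"
        using transfer(2)[OF i, of snd] Y_int eps_int[OF i] by simp
    qed (use model[OF i] in simp)
    have "expectation (\<lambda>x. U i x * T i x) = expectation (\<lambda>x. ?G (Xs i x) * (r (Xs i x) - a) + ?G (Xs i x) * eps i x)"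
      using model[OF i] by (intro Bochner_Integration.integral_cong) (auto simp: U_def T_def algebra_simps)
    also have "\<dots> = expectation (\<lambda>x. ?G (Xs i x) * (r (Xs i x) - a)) + expectation (\<lambda>x. ?G (Xs i x) * eps i x)"
      by (intro Bochner_Integration.integral_add bounded_mult[OF i G] ri eps_int(1)[OF i])
    also have "\<dots> = expectation (\<lambda>x. ?G (Xs i x) * (r (Xs i x) - a))"
      using eps_zero[OF i G] by simp
    also have "\<dots> = expectation (\<lambda>x. ?G (X x) * (r (X x) - a))"
      by (rule transfer_X[OF i]) simp
    finally show ?thesis by (simp add: Z_def)
  qed

  \<comment> \<open>Only eventually: expanding the square needs \<open>r - a\<close> bounded on the
    support of the kernel, which continuity at \<open>chi\<close> provides once
    \<open>h i < d\<close>. The cross term then vanishes and \<sigma>2 replaces the squared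
    error.\<close>
  have UT2_eq: "\<forall>\<^sub>F i in sequentially. expectation (\<lambda>x. (U i x * T i x)\<^sup>2) =
      expectation (\<lambda>x. (r (X x) - a)\<^sup>2 * (K (Z x / h i))\<^sup>2) + expectation (\<lambda>x. \<sigma>2 (X x) * (K (Z x / h i))\<^sup>2)"
  proof -
    obtain d where d: "d > 0" "\<And>y. q y < d \<Longrightarrow> \<bar>r y - a\<bar> < 1"
      using cont_at[OF r_cont, of 1] by (auto simp: a_def)
    have "\<forall>\<^sub>F i in sequentially. h i < d" by (rule order_tendstoD(2)[OF h_lim d(1)])
    then show ?thesis using eventually_ge_at_top[of 1]
    proof eventually_elim
      case (elim i)
      then have i: "i \<ge> 1" and hd: "h i < d" by simp_all
      let ?k = "\<lambda>y. (K (q y / h i))\<^sup>2"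
      have k: "?k y = 0 \<or> \<bar>r y - a\<bar> < 1" for y
      proof (cases "q y / h i \<in> {0..1}")
        case True
        then have "q y \<le> h i" using h_pos[OF i] by (simp add: field_simps)
        then show ?thesis using d(2) hd by auto
      qed (simp add: K_support)
      have k_b: "\<bar>?k y\<bar> \<le> b0\<^sup>2" for y using K2_le by simp
      have k1: "\<bar>?k y * (r y - a)\<bar> \<le> b0\<^sup>2" for y
        using k[of y] K2_le[of "q y / h i"] mult_mono[of "?k y" "b0\<^sup>2" "\<bar>r y - a\<bar>" 1] by (auto simp: abs_mult)
      have k2: "\<bar>?k y * (r y - a)\<^sup>2\<bar> \<le> b0\<^sup>2" for y
        using k[of y] K2_le[of "q y / h i"] mult_mono[of "?k y" "b0\<^sup>2" "\<bar>r y - a\<bar>\<^sup>2" 1]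
        by (auto simp: abs_mult abs_square_le_1 power_le_one)
      have m1: "(\<lambda>y. ?k y * (r y - a)) \<in> borel_measurable borel" and m2: "(\<lambda>y. ?k y * (r y - a)\<^sup>2) \<in> borel_measurable borel"
        and m3: "?k \<in> borel_measurable borel" by measurable
      let ?A = "\<lambda>x. ?k (Xs i x) * (r (Xs i x) - a)\<^sup>2" and ?B = "\<lambda>x. ?k (Xs i x) * (r (Xs i x) - a) * eps i x"
        and ?C = "\<lambda>x. ?k (Xs i x) * (eps i x)\<^sup>2"
      have A: "integrable M ?A"
        using bounded_mult[OF i m2 k2, of "\<lambda>_. 1"] by simp
      have B: "integrable M ?B"
        by (rule bounded_mult[OF i m1 k1 eps_int(1)[OF i]])
      have C: "integrable M ?C"
        by (rule bounded_mult[OF i m3 k_b eps_int(2)[OF i]])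
      have "expectation (\<lambda>x. (U i x * T i x)\<^sup>2) = expectation (\<lambda>x. ?A x + 2 * ?B x + ?C x)"
        using model[OF i] by (intro Bochner_Integration.integral_cong) (auto simp: U_def T_def power2_eq_square algebra_simps)
      also have "\<dots> = expectation ?A + 2 * expectation ?B + expectation ?C"
        using A B C by simp
      also have "expectation ?B = 0" by (rule eps_zero[OF i m1 k1])
      also have "expectation ?C = expectation (\<lambda>x. ?k (Xs i x) * \<sigma>2 (Xs i x))"
        by (rule cond_exp_given_integral[OF prob eps_var[OF i] Xs_meas[OF i] m3 C])
      also have "\<dots> = expectation (\<lambda>x. ?k (X x) * \<sigma>2 (X x))"
        by (rule transfer_X[OF i]) measurable
      also have "expectation ?A = expectation (\<lambda>x. ?k (X x) * (r (X x) - a)\<^sup>2)"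
        by (rule transfer_X[OF i m2])
      finally show ?case by (simp add: Z_def mult.commute)
    qed
  qed

  \<comment> \<open>Its integral formula hides the sign of \<open>M1\<close>. As a limit of kernel
    means divided by \<open>F t\<close> it is at least the infimum of \<open>K\<close> on
    \<open>{0..1}\<close>.\<close>
  have M1_pos: "0 < M1 K \<tau>0"
  proof -
    define k0 where "k0 = (INF t\<in>{0..1}. K t)"
    have k0: "k0 \<le> K t" if "t \<in> {0..1}" for t
      unfolding k0_def using that K_nonneg by (intro cINF_lower) (auto intro!: bdd_belowI2[of _ 0])
    have "k0 \<le> M1 K \<tau>0"
    proof (rule tendsto_lowerbound[OF M1])
      show "\<forall>\<^sub>F t in at_right 0. k0 \<le> expectation (\<lambda>x. K (Z x / t)) / F t"
        unfolding eventually_at_right_field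
      proof (intro exI[of _ 1] conjI allI impI)
        fix t :: real assume t: "0 < t"
        have "k0 * F t = expectation (\<lambda>x. k0 * indicator {..t} (Z x))"
          by (simp add: B.F_eq_expectation)
        also have "\<dots> \<le> expectation (\<lambda>x. K (Z x / t))"
        proof (rule integral_mono)
          show "integrable M (\<lambda>x. k0 * indicator {..t} (Z x))"
            by (intro integrable_mult_right integrable_const_bound[where B=1]) (auto simp: indicator_def)
          show "integrable M (\<lambda>x. K (Z x / t))"
            by (rule integrable_const_bound[where B=b0]) (auto simp: K_nonneg b0)
          show "k0 * indicator {..t} (Z x) \<le> K (Z x / t)" if "x \<in> space M" for x
            using that t k0[of "Z x / t"] K_nonneg B.Z_nonneg by (auto simp: indicator_def)
        qed
        finally show "k0 \<le> expectation (\<lambda>x. K (Z x / t)) / F t"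
          using F_pos[OF t] by (simp add: field_simps)
      qed simp
    qed simp
    then show ?thesis using K_inf by (simp add: k0_def)
  qed

  interpret A: recursive_kernel_array M U T f h b \<beta> l b0 C \<alpha> c "M1 K \<tau>0" "M2 K \<tau>0" "M0 K \<tau>0 * \<phi>'" "\<sigma>2 chi * M2 K \<tau>0"
  proof unfold_locales
    show "indep_vars (\<lambda>_. borel \<Otimes>\<^sub>M borel) (\<lambda>i x. (U i x, T i x)) {1..}"
      using indep_vars_compose2[OF indep, of "\<lambda>i z. (K (q (fst z) / h i), snd z - a)" "\<lambda>_. borel \<Otimes>\<^sub>M borel"]
      by (simp add: U_def T_def)
    show "0 \<le> U i x" "U i x \<le> b0" for i x by (simp_all add: U_def K_nonneg b0)
    show "integrable M (\<lambda>x. (T i x)\<^sup>2)" if "i \<ge> 1" for i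
      using transfer(2)[OF that, of "\<lambda>z. (snd z - a)\<^sup>2"] Y2 by (simp add: T_def)
    show "0 < f i" "f i \<le> 1" if "i \<ge> 1" for i using h_pos[OF that] by (simp_all add: f_def F_pos B.F_le_1)
    show "0 \<le> l" "l \<le> 1" using l_range by auto
    show "(\<lambda>i. expectation (U i) / f i) \<longlonglongrightarrow> M1 K \<tau>0"
    proof (rule Lim_transform_eventually[OF filterlim_compose[OF M1 h_right]])
      show "\<forall>\<^sub>F i in sequentially. expectation (\<lambda>x. K (Z x / h i)) / F (h i) = expectation (U i) / f i"
        using eventually_ge_at_top[of 1]
      proof eventually_elim
        case (elim i)
        then show ?case
          using transfer_X[of i "\<lambda>y. K (q y / h i)"] by (simp add: U_def[abs_def] Z_def f_def)
      qed
    qed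
    show "(\<lambda>i. expectation (\<lambda>x. (U i x)\<^sup>2) / f i) \<longlonglongrightarrow> M2 K \<tau>0"
    proof (rule Lim_transform_eventually[OF filterlim_compose[OF M2 h_right]])
      show "\<forall>\<^sub>F i in sequentially. expectation (\<lambda>x. (K (Z x / h i))\<^sup>2) / F (h i) = expectation (\<lambda>x. (U i x)\<^sup>2) / f i"
        using eventually_ge_at_top[of 1]
      proof eventually_elim
        case (elim i)
        then show ?case
          using transfer_X[of i "\<lambda>y. (K (q y / h i))\<^sup>2"] by (simp add: U_def Z_def f_def)
      qed
    qed
    show "(\<lambda>i. expectation (\<lambda>x. U i x * T i x) / (h i * f i)) \<longlonglongrightarrow> M0 K \<tau>0 * \<phi>'"
    proof (rule Lim_transform_eventually[OF filterlim_compose[OF L_mean h_right]])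
      show "\<forall>\<^sub>F i in sequentially. expectation (\<lambda>x. K (Z x / h i) * (r (X x) - a)) / (h i * F (h i)) =
          expectation (\<lambda>x. U i x * T i x) / (h i * f i)"
        using eventually_ge_at_top[of 1] by eventually_elim (simp add: UT_eq f_def)
    qed
    have L: "((\<lambda>t. expectation (\<lambda>x. (r (X x) - a)\<^sup>2 * (K (Z x / t))\<^sup>2) / F t +
        expectation (\<lambda>x. \<sigma>2 (X x) * (K (Z x / t))\<^sup>2) / F t) \<longlongrightarrow> \<sigma>2 chi * M2 K \<tau>0) (at_right 0)"
      using tendsto_add[OF L_bias L_var] by simp
    show "(\<lambda>i. expectation (\<lambda>x. (U i x * T i x)\<^sup>2) / f i) \<longlonglongrightarrow> \<sigma>2 chi * M2 K \<tau>0"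
    proof (rule Lim_transform_eventually[OF filterlim_compose[OF L h_right]])
      show "\<forall>\<^sub>F i in sequentially. expectation (\<lambda>x. (r (X x) - a)\<^sup>2 * (K (Z x / h i))\<^sup>2) / F (h i) +
          expectation (\<lambda>x. \<sigma>2 (X x) * (K (Z x / h i))\<^sup>2) / F (h i) = expectation (\<lambda>x. (U i x * T i x)\<^sup>2) / f i"
        using UT2_eq by eventually_elim (simp add: f_def add_divide_distrib)
    qed
    show "0 \<le> b n" for n using b'_nonneg by (simp add: b_def)
    show "(\<lambda>n. b n / sqrt (real n * f n)) \<longlonglongrightarrow> 0"
    proof -
      have "filterlim (\<lambda>n. sqrt (real n * F (h n))) at_top sequentially"
        by (rule filterlim_compose[OF sqrt_at_top nF_lim])
      from tendsto_inverse_0_at_top[OF this]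
      have "(\<lambda>n. \<bar>a\<bar> * inverse (sqrt (real n * F (h n)))) \<longlonglongrightarrow> \<bar>a\<bar> * 0"
        by (rule tendsto_mult_left)
      from tendsto_add[OF tendsto_mult_left[OF log_cond[of "1 / \<mu>"], of "(4 / lam) powr (1 / \<mu>)"] this]
      have "(\<lambda>n. (4 / lam) powr (1 / \<mu>) * (ln (real n) powr (1 / \<mu>) / sqrt (real n * F (h n))) +
          \<bar>a\<bar> * inverse (sqrt (real n * F (h n)))) \<longlonglongrightarrow> 0"
        using lam by simp
      then show ?thesis
      proof (rule Lim_transform_eventually)
        show "\<forall>\<^sub>F n in sequentially. (4 / lam) powr (1 / \<mu>) * (ln (real n) powr (1 / \<mu>) / sqrt (real n * F (h n))) +
          \<bar>a\<bar> * inverse (sqrt (real n * F (h n))) = b n / sqrt (real n * f n)"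
          using eventually_ge_at_top[of 1]
        proof eventually_elim
          case (elim n)
          have "b' n = (4 / lam) powr (1 / \<mu>) * ln (real n) powr (1 / \<mu>)"
            unfolding b'_def using elim lam by (subst powr_mult) auto
          then show ?case by (simp add: b_def f_def add_divide_distrib inverse_eq_divide)
        qed
      qed
    qed
    show "expectation (\<lambda>x. (T i x)\<^sup>2 * indicator {b n<..} \<bar>T i x\<bar>) \<le> C / (real n)\<^sup>2" if i: "i \<ge> 1" and n: "n \<ge> 1" for i n
    proof -
      have "expectation (\<lambda>x. (T i x)\<^sup>2 * indicator {b n<..} \<bar>T i x\<bar>) =
          expectation (\<lambda>x. (Y x - a)\<^sup>2 * indicator {b n<..} \<bar>Y x - a\<bar>)"
        using transfer(1)[OF i, of "\<lambda>z. (snd z - a)\<^sup>2 * indicator {b n<..} \<bar>snd z - a\<bar>"] by (simp add: T_def)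
      also have "\<dots> \<le> expectation (\<lambda>x. (Y x - a)\<^sup>2 * indicator {b' n<..} \<bar>Y x\<bar>)"
      proof (rule integral_mono)
        show "integrable M (\<lambda>x. (Y x - a)\<^sup>2 * indicator {b n<..} \<bar>Y x - a\<bar>)"
          "integrable M (\<lambda>x. (Y x - a)\<^sup>2 * indicator {b' n<..} \<bar>Y x\<bar>)"
          by (rule Bochner_Integration.integrable_bound[OF Y2]; auto simp: indicator_def)+
        show "(Y x - a)\<^sup>2 * indicator {b n<..} \<bar>Y x - a\<bar> \<le> (Y x - a)\<^sup>2 * indicator {b' n<..} \<bar>Y x\<bar>" for x
          by (intro mult_left_mono) (auto simp: indicator_def b_def)
      qed
      also have "\<dots> \<le> C * exp (- (lam / 2) * b' n powr \<mu>)" by (rule C[OF b'_nonneg])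
      also have "b' n powr \<mu> = 4 / lam * ln (real n)"
        unfolding b'_def using lam n by (simp add: powr_powr)
      also have "exp (- (lam / 2) * (4 / lam * ln (real n))) = 1 / (real n)\<^sup>2"
      proof -
        have "- (lam / 2) * (4 / lam * ln (real n)) = - (ln (real n) + ln (real n))" using lam by simp
        then show ?thesis using n by (simp only: exp_minus exp_add) (simp add: power2_eq_square inverse_eq_divide)
      qed
      finally show ?thesis by simp
    qed
    show "(\<lambda>n. 1 / real n * (\<Sum>i=1..n. (f i / f n) powr s)) \<longlonglongrightarrow> \<beta> s" if "s \<le> 2" for s
      unfolding f_def by (rule B_lim[OF that])
  qed (use h_pos h_lim nF_lim A_lim c_lim M1_pos in \<open>simp_all add: f_def\<close>)

  let ?W = "\<lambda>n x. sqrt (real n * F (h n)) * (recursive_estimator p K F h l Xs Ys chi n x - r chi)"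
  have "weak_conv_m (\<lambda>n. distr M borel (?W n))
      (normal_law (c * \<alpha> * (M0 K \<tau>0 * \<phi>') / (\<beta> (1 - l) * M1 K \<tau>0))
        (\<beta> (1 - 2 * l) * (\<sigma>2 chi * M2 K \<tau>0) / (\<beta> (1 - l) * M1 K \<tau>0)\<^sup>2))"
  proof (rule A.weak_conv_self_normalized_sum)
    show "random_variable borel (?W n)" for n
    proof -
      have m: "random_variable borel (\<lambda>x. K (q (Xs i x) / h i))" if "i \<in> {1..n}" for i
        using Xs_meas[of i] that by simp
      show ?thesis unfolding recursive_estimator_def p_sym
        by (intro borel_measurable_times borel_measurable_diff borel_measurable_divide borel_measurable_sum
            borel_measurable_const m Ys_meas) auto
    qed
    fix n x
    let ?w = "\<lambda>i. f i powr (- l)"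
    assume nz: "(\<Sum>i=1..n. ?w i * U i x) \<noteq> 0"
    \<comment> \<open>Writing \<open>Ys i x = T i x + a\<close> splits off \<open>a\<close> times
      the denominator, which cancels \<open>r chi\<close> where the denominator is nonzero.\<close>
    have "(\<Sum>i=1..n. Ys i x / F (h i) powr l * K (p (chi - Xs i x) / h i)) =
        (\<Sum>i=1..n. ?w i * (U i x * T i x)) + a * (\<Sum>i=1..n. ?w i * U i x)"
      by (simp add: U_def T_def f_def p_sym powr_minus_divide sum_distrib_left sum.distrib[symmetric] algebra_simps
          diff_divide_distrib sum_subtractf)
    moreover have "(\<Sum>i=1..n. 1 / F (h i) powr l * K (p (chi - Xs i x) / h i)) = (\<Sum>i=1..n. ?w i * U i x)"
      by (simp add: U_def f_def p_sym powr_minus_divide)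
    ultimately show "?W n x = sqrt (real n * f n) * ((\<Sum>i=1..n. ?w i * (U i x * T i x)) / (\<Sum>i=1..n. ?w i * U i x))"
      unfolding recursive_estimator_def using nz by (simp add: add_divide_distrib a_def f_def)
  qed
  then show ?thesis by (simp add: mult_ac power_mult_distrib)
qed

end
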